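(* Let $X$ be a real-valued Lévy process of infinite variation with Gaussian coefficient $\sigma=0$, Lévy measure $\nu$ and Blumenthal--Getoor index $\beta$. If $\beta\in(1,2)$, then $J_\beta<\infty$ if and only if $I_\beta<\infty$. If $\beta=2$, then $\int_0^1\log(1/t)\,\overline{\nu}(\sqrt t)\,dt<\infty$ implies $I_2<\infty$.
   Context: $X=(X_t)_{t\ge0}$ is a Lévy process on $\mathbb{R}$ (càdlàg, $X_0=0$). It is of infinite variation if its paths a.s. have infinite variation on compact intervals; when $\sigma=0$ this is equivalent to $\int_{(-1,1)}|x|\,\nu(dx)=\infty$. For $p>0$ let $J_p=\int_{(-1,1)}|x|^p\,\nu(dx)$, and let $\beta=\inf\{p>0:J_p<\infty\}$ be the Blumenthal--Getoor index. For $u\in(0,1]$ let $\overline{\nu}(u)=\nu(\mathbb{R}\setminus(-u,u))$. For $\beta\in(1,2]$ define $$I_\beta=\int_0^1\mathbb{E}\big[\min\{(|X_t|/t^{1/\beta})^{\beta/(\beta-1)},1\}\big]\frac{dt}{t}\in(0,\infty].$$ *)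

theory Defs
  imports "HOL-Probability.Probability"
begin

definition cadlag :: "(real \<Rightarrow> real) \<Rightarrow> bool" where
  "cadlag f \<longleftrightarrow> (\<forall>t\<ge>0. continuous (at_right t) f) \<and> (\<forall>t>0. \<exists>l. (f \<longlongrightarrow> l) (at_left t))"

text \<open>
  The time index is \<open>real\<close>; only the times \<open>t \<ge> 0\<close> are constrained or used.
  The path properties are required almost surely.
\<close>

locale levy_process = prob_space M
  for M :: "'a measure" and X :: "real \<Rightarrow> 'a \<Rightarrow> real" +
  assumes random_variable: "\<And>t. 0 \<le> t \<Longrightarrow> random_variable borel (X t)"
    and start_zero: "AE \<omega> in M. X 0 \<omega> = 0"
    and cadlag_paths: "AE \<omega> in M. cadlag (\<lambda>t. X t \<omega>)"
    and independent_increments: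
      "\<And>(n::nat) (t::nat \<Rightarrow> real). 0 \<le> t 0 \<Longrightarrow> strict_mono_on {..n} t \<Longrightarrow>
         indep_vars (\<lambda>_. borel) (\<lambda>i \<omega>. X (t (Suc i)) \<omega> - X (t i) \<omega>) {..<n}"
    and stationary_increments:
      "\<And>s h. 0 \<le> s \<Longrightarrow> 0 \<le> h \<Longrightarrow>
         distr M borel (\<lambda>\<omega>. X (s + h) \<omega> - X s \<omega>) = distr M borel (X h)"

definition total_variation :: "(real \<Rightarrow> real) \<Rightarrow> real \<Rightarrow> real \<Rightarrow> ennreal" where
  "total_variation f a b =
     (SUP (n, t) \<in> {(n::nat, t::nat \<Rightarrow> real). mono_on {..n} t \<and> t 0 = a \<and> t n = b}.
        \<Sum>i<n. ennreal \<bar>f (t (Suc i)) - f (t i)\<bar>)"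

definition infinite_variation :: "'a measure \<Rightarrow> (real \<Rightarrow> 'a \<Rightarrow> real) \<Rightarrow> bool" where
  "infinite_variation M X \<longleftrightarrow>
     (AE \<omega> in M. \<forall>a b. 0 \<le> a \<and> a < b \<longrightarrow> total_variation (\<lambda>t. X t \<omega>) a b = \<infinity>)"

definition levy_measure :: "real measure \<Rightarrow> bool" where
  "levy_measure \<nu> \<longleftrightarrow> sets \<nu> = sets borel \<and> emeasure \<nu> {0} = 0 \<and>
     (\<integral>\<^sup>+x. ennreal (min 1 (x\<^sup>2)) \<partial>\<nu>) < \<infinity>"

definition levy_exponent :: "real \<Rightarrow> real \<Rightarrow> real measure \<Rightarrow> real \<Rightarrow> complex" where
  "levy_exponent \<gamma> \<sigma> \<nu> u =
     \<i> * complex_of_real (\<gamma> * u) - complex_of_real (\<sigma>\<^sup>2 * u\<^sup>2 / 2)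
     + (CLINT x|\<nu>. iexp (u * x) - 1 - \<i> * complex_of_real (u * x * indicator {-1<..<1} x))"

text \<open>
  By the Levy--Khintchine formula every Levy process has such a triplet, and \<open>\<sigma>\<^sup>2\<close> and \<open>\<nu>\<close>
  do not depend on the truncation function; only \<open>\<gamma>\<close> does.
\<close>

definition has_levy_triplet ::
    "'a measure \<Rightarrow> (real \<Rightarrow> 'a \<Rightarrow> real) \<Rightarrow> real \<Rightarrow> real \<Rightarrow> real measure \<Rightarrow> bool" where
  "has_levy_triplet M X \<gamma> \<sigma> \<nu> \<longleftrightarrow> 0 \<le> \<sigma> \<and> levy_measure \<nu> \<and>
     (\<forall>t\<ge>0. \<forall>u. char (distr M borel (X t)) u = exp (complex_of_real t * levy_exponent \<gamma> \<sigma> \<nu> u))"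

definition J_integral :: "real measure \<Rightarrow> real \<Rightarrow> ennreal" where
  "J_integral \<nu> p = (\<integral>\<^sup>+x\<in>{-1<..<1}. ennreal (\<bar>x\<bar> powr p) \<partial>\<nu>)"

text \<open>
  The infimum is over a nonempty set bounded below when \<open>\<nu>\<close> is a Levy measure, since \<open>p = 2\<close>
  always belongs to it, so the real-valued \<open>Inf\<close> is the intended one.
\<close>

definition blumenthal_getoor_index :: "real measure \<Rightarrow> real" where
  "blumenthal_getoor_index \<nu> = Inf {p. 0 < p \<and> J_integral \<nu> p < \<infinity>}"

definition nu_bar :: "real measure \<Rightarrow> real \<Rightarrow> ennreal" where
  "nu_bar \<nu> u = emeasure \<nu> (UNIV - {-u<..<u})"

definition I_integral :: "'a measure \<Rightarrow> (real \<Rightarrow> 'a \<Rightarrow> real) \<Rightarrow> real \<Rightarrow> ennreal" where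
  "I_integral M X \<beta> =
     (\<integral>\<^sup>+t\<in>{0<..1}. ennreal
        ((LINT \<omega>|M. min ((\<bar>X t \<omega>\<bar> / t powr (1 / \<beta>)) powr (\<beta> / (\<beta> - 1))) 1) / t) \<partial>lborel)"

end

theory Submission
  imports Defs
begin

text \<open>
The proof works with the marginal laws through their characteristic functions
\<open>exp (t * \<psi>)\<close>, together with the fact that \<open>X t\<close> is the sum of \<open>n\<close> independent increments distributed as \<open>X (t / n)\<close>.

Upper bound on the process. Averaging \<open>1 - cos (s * y)\<close> over \<open>s\<close> in \<open>[0, 1]\<close> gives a function comparable
to \<open>min 1 (y\<^sup>2)\<close>, so a truncated second moment of \<open>X t\<close> at scale \<open>a\<close> is at most a constant times the
supremum of \<open>\<bar>1 - exp (t * \<psi> v)\<bar> \<le> 2 * t * \<bar>\<psi> v\<bar>\<close> over \<open>\<bar>v\<bar> \<le> 1 / a\<close>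
(\<open>truncated_second_moment_le_levy_growth\<close>). With \<open>a = t powr (1 / \<beta>)\<close> the factor \<open>t\<close> cancels the \<open>1 / t\<close>
of the integral \<open>I\<close>, and since \<open>\<beta> / (\<beta> - 1) \<ge> 2\<close> the power in \<open>I\<close> is dominated by the square.
What remains is the integral over \<open>t\<close> of a bound for \<open>\<psi> (t powr (-1 / \<beta>))\<close>. By Tonelli it is, up to finite
terms, the \<open>\<nu>\<close>-integral of an explicit function of the jump size \<open>x\<close>, which is of order \<open>\<bar>x\<bar> powr \<beta>\<close> for
\<open>\<beta> < 2\<close> and of order \<open>x\<^sup>2 * (1 + ln (1 / x\<^sup>2))\<close> for \<open>\<beta> = 2\<close>. The first is integrable when \<open>J\<close> is
finite, the second under the logarithmic condition.

Lower bound on the process. If \<open>P(\<bar>X t\<bar> \<ge> a)\<close> is small, then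
\<open>t * \<nu>(\<bar>x\<bar> \<ge> 512 * a) \<le> 2 * P(\<bar>X t\<bar> \<ge> a)\<close> (\<open>levy_measure_tail_le\<close>).
To see this, split \<open>X t\<close> into \<open>n\<close> increments. When exactly one of them is much larger than \<open>a\<close> and the sum of
the others is moderate, \<open>\<bar>X t\<bar>\<close> exceeds \<open>a\<close>; these \<open>n\<close> events are disjoint, and by independence each has
probability comparable to that of a large increment (\<open>single_big_jump\<close>). As \<open>n\<close> grows, \<open>n\<close> times the law of
\<open>X (t / n)\<close> converges to \<open>t * \<nu>\<close> away from \<open>0\<close> (\<open>levy_small_time_limit\<close>), which turns large increments into
the tail of \<open>\<nu>\<close>. That the expected number of large increments is small, so that two of them rarely occur
together, follows from the characteristic function: it stays close to \<open>1\<close> near \<open>0\<close>, and this bounds the tail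
of \<open>\<nu>\<close> at a multiple of \<open>a\<close>.

Finally \<open>a = t powr (1 / \<beta>)\<close> is inserted and both integrals are compared with sums over the dyadic intervals
\<open>((1/2) ^ Suc k, (1/2) ^ k]\<close>. If \<open>I\<close> is finite then the sum of the minima of a constant and
\<open>(1/2) ^ k * \<nu>(\<bar>x\<bar> \<ge> 512 * (1/2) powr (k / \<beta>))\<close> is finite, the minimum is eventually irrelevant, and the
remaining sum dominates \<open>J\<close>.
\<close>

section \<open>Truncated second moments and characteristic functions\<close>

text \<open>
For \<open>\<bar>y\<bar> \<ge> 2\<close> the quotient is at most \<open>1/2\<close>; below that, the cubic Taylor polynomial of the sine with its
remainder leaves a gap of at least \<open>2 * y\<^sup>2 / 15\<close>.
\<close>

lemma one_minus_sinc_ge: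
  fixes y :: real
  assumes "y \<noteq> 0"
  shows "min 1 (y\<^sup>2) \<le> 8 * (1 - sin y / y)"
proof -
  have pos: "min 1 (z\<^sup>2) \<le> 8 * (1 - sin z / z)" if z: "z > 0" for z :: real
  proof (cases "z \<ge> 2")
    case True
    have "sin z / z \<le> 1 / 2"
      using True order_trans[OF sin_le_one[of z], of "z / 2"] by (simp add: field_simps)
    then show ?thesis by (simp add: min_def)
  next
    case False
    have "{..<5} = {0, 1, 2, 3, 4::nat}" by auto
    then have sum: "(\<Sum>m<5. sin_coeff m * z ^ m) = z - z ^ 3 / 6"
      by (simp add: sin_coeff_def fact_numeral)
    have "\<bar>sin z - (z - z ^ 3 / 6)\<bar> \<le> z ^ 5 / 120"
      using Maclaurin_sin_bound[of z 5] z unfolding sum by (simp add: fact_numeral field_simps)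
    then have "sin z \<le> z - z ^ 3 / 6 + z ^ 5 / 120" by linarith
    also have "z ^ 5 \<le> 4 * z ^ 3"
      using z False mult_mono[of z 2 z 2] by (simp add: eval_nat_numeral)
    finally have "sin z \<le> z - 2 * z ^ 3 / 15" by simp
    moreover have "z ^ 3 \<ge> 0" using z by simp
    ultimately have "sin z \<le> z - z ^ 3 / 8" by linarith
    then have "sin z / z \<le> (z - z ^ 3 / 8) / z"
      using z by (intro divide_right_mono) auto
    also have "\<dots> = 1 - z\<^sup>2 / 8" using z by (simp add: field_simps eval_nat_numeral)
    finally show ?thesis by (simp add: min_def)
  qed
  show ?thesis
    using assms pos[of y] pos[of "-y"] by (cases "y > 0") auto
qed

text \<open>
The average on the right is \<open>1 - sin y / y\<close>.
\<close>

lemma min_square_le_average_one_minus_cos: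
  fixes y :: real
  shows "ennreal (min 1 (y\<^sup>2)) \<le> 8 * (\<integral>\<^sup>+s\<in>{0..1}. ennreal (1 - cos (s * y)) \<partial>lborel)"
proof (cases "y = 0")
  case False
  have "((\<lambda>s. 1 - cos (s * y)) has_integral (1 - sin (1 * y) / y) - (0 - sin (0 * y) / y)) {0..1}"
    using False
    by (intro fundamental_theorem_of_calculus)
       (auto intro!: derivative_eq_intros simp flip: has_real_derivative_iff_has_vector_derivative)
  then have "((\<lambda>s. 1 - cos (s * y)) has_integral (1 - sin y / y)) {0..1}"
    by simp
  from nn_integral_has_integral_lebesgue'[OF _ this]
  have "(\<integral>\<^sup>+s\<in>{0..1}. ennreal (1 - cos (s * y)) \<partial>lborel) = ennreal (1 - sin y / y)"
    by simp
  moreover have "8 * ennreal (1 - sin y / y) = ennreal (8 * (1 - sin y / y))"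
    by (subst ennreal_mult') auto
  ultimately show ?thesis
    using one_minus_sinc_ge[OF False] by (simp add: ennreal_leI)
qed auto

text \<open>
A measure whose integrals of \<open>1 - cos\<close> are small at all frequencies up to \<open>u\<close> has little mass
beyond \<open>1 / u\<close>. The lemma serves both for the laws of the process, where the integrals are
\<open>1 - Re (char \<mu> v)\<close>, and for the Levy measure, where they are \<open>- Re (\<psi> v)\<close>.
\<close>

lemma truncated_second_moment_le:
  fixes \<mu> :: "real measure" and u :: real and K :: ennreal
  assumes "sigma_finite_measure \<mu>" and [measurable_cong]: "sets \<mu> = sets borel"
    and K: "\<And>s. s \<in> {0..1} \<Longrightarrow> (\<integral>\<^sup>+x. ennreal (1 - cos (s * u * x)) \<partial>\<mu>) \<le> K"
  shows "(\<integral>\<^sup>+x. ennreal (min 1 ((u * x)\<^sup>2)) \<partial>\<mu>) \<le> 8 * K"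
proof -
  interpret sigma_finite_measure \<mu> by fact
  interpret pair_sigma_finite \<mu> lborel by unfold_locales
  have "(\<integral>\<^sup>+x. ennreal (min 1 ((u * x)\<^sup>2)) \<partial>\<mu>)
      \<le> (\<integral>\<^sup>+x. 8 * (\<integral>\<^sup>+s\<in>{0..1}. ennreal (1 - cos (s * (u * x))) \<partial>lborel) \<partial>\<mu>)"
    by (intro nn_integral_mono min_square_le_average_one_minus_cos)
  also have "\<dots> = 8 * (\<integral>\<^sup>+x. (\<integral>\<^sup>+s\<in>{0..1}. ennreal (1 - cos (s * (u * x))) \<partial>lborel) \<partial>\<mu>)"
    by (intro nn_integral_cmult) measurable
  also have "(\<integral>\<^sup>+x. (\<integral>\<^sup>+s\<in>{0..1}. ennreal (1 - cos (s * (u * x))) \<partial>lborel) \<partial>\<mu>)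
      = (\<integral>\<^sup>+s. (\<integral>\<^sup>+x. ennreal (1 - cos (s * (u * x))) * indicator {0..1} s \<partial>\<mu>) \<partial>lborel)"
    by (rule Fubini'[symmetric]) measurable
  also have "\<dots> = (\<integral>\<^sup>+s. (\<integral>\<^sup>+x. ennreal (1 - cos (s * (u * x))) \<partial>\<mu>) * indicator {0..1} s \<partial>lborel)"
    by (intro nn_integral_cong nn_integral_multc) measurable
  also have "\<dots> \<le> (\<integral>\<^sup>+s. K * indicator {0..1::real} s \<partial>lborel)"
    using K by (intro nn_integral_mono) (auto simp: indicator_def mult.assoc)
  also have "\<dots> = K" by (simp add: nn_integral_cmult_indicator)
  finally show ?thesis by (simp add: mult_left_mono)
qed

lemma emeasure_tail_le_truncated_second_moment:
  fixes \<mu> :: "real measure"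
  assumes [measurable_cong]: "sets \<mu> = sets borel" and b: "0 < b"
  shows "emeasure \<mu> (UNIV - {-b<..<b}) \<le> (\<integral>\<^sup>+x. ennreal (min 1 ((1 / b * x)\<^sup>2)) \<partial>\<mu>)"
proof -
  have "emeasure \<mu> (UNIV - {-b<..<b}) = (\<integral>\<^sup>+x. indicator (UNIV - {-b<..<b}) x \<partial>\<mu>)" by simp
  also have "\<dots> \<le> (\<integral>\<^sup>+x. ennreal (min 1 ((1 / b * x)\<^sup>2)) \<partial>\<mu>)"
  proof (intro nn_integral_mono)
    fix x
    show "indicator (UNIV - {-b<..<b}) x \<le> ennreal (min 1 ((1 / b * x)\<^sup>2))"
    proof (cases "x \<in> UNIV - {-b<..<b}")
      case True
      then have "b \<le> \<bar>x\<bar>" by auto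
      then have "\<bar>1\<bar> \<le> \<bar>1 / b * x\<bar>" using b by (simp add: abs_mult field_simps)
      then have "1\<^sup>2 \<le> (1 / b * x)\<^sup>2" by (simp only: abs_le_square_iff)
      then show ?thesis using True by (simp add: min_def)
    qed simp
  qed
  finally show ?thesis .
qed

text \<open>
Split at \<open>\<bar>x\<bar> = a\<close> in \<open>\<bar>iexp (u * x) - 1\<bar> \<le> min (\<bar>u * x\<bar>) 2\<close>.
\<close>

lemma one_minus_norm_char_le:
  assumes "real_distribution \<mu>" "0 \<le> a"
  shows "1 - norm (char \<mu> u) \<le> \<bar>u\<bar> * a + 2 * measure \<mu> {x. a \<le> \<bar>x\<bar>}"
proof -
  interpret real_distribution \<mu> by fact
  have int: "integrable \<mu> (\<lambda>x. iexp (u * x))" by (intro integrable_iexp) simp_all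
  have "1 - norm (char \<mu> u) \<le> norm (char \<mu> u - 1)"
    using norm_triangle_ineq2[of 1 "char \<mu> u"] by (simp add: norm_minus_commute)
  also have "char \<mu> u - 1 = (CLINT x|\<mu>. iexp (u * x) - 1)"
    using int prob_space unfolding char_def by simp
  also have "norm \<dots> \<le> (LINT x|\<mu>. norm (iexp (u * x) - 1))" by (rule integral_norm_bound)
  also have "\<dots> \<le> (LINT x|\<mu>. \<bar>u\<bar> * a + 2 * indicator {x. a \<le> \<bar>x\<bar>} x)"
  proof (rule integral_mono)
    show "integrable \<mu> (\<lambda>x. norm (iexp (u * x) - 1))" using int by simp
    show "integrable \<mu> (\<lambda>x. \<bar>u\<bar> * a + 2 * indicator {x. a \<le> \<bar>x\<bar>} x)"
      by (intro Bochner_Integration.integrable_add integrable_mult_right integrable_const)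
        (simp add: less_top[symmetric])
    fix x
    have "norm (iexp (u * x) - 1) \<le> \<bar>u\<bar> * \<bar>x\<bar>"
      using iexp_approx1[of "u * x" 0] by (simp add: abs_mult)
    moreover have "norm (iexp (u * x) - 1) \<le> 2"
      using norm_triangle_ineq4[of "iexp (u * x)" 1] by simp
    moreover have "\<bar>u\<bar> * \<bar>x\<bar> \<le> \<bar>u\<bar> * a" if "\<not> a \<le> \<bar>x\<bar>" using that by (intro mult_left_mono) auto
    ultimately show "norm (iexp (u * x) - 1) \<le> \<bar>u\<bar> * a + 2 * indicator {x. a \<le> \<bar>x\<bar>} x"
      using assms by (cases "a \<le> \<bar>x\<bar>") (simp_all add: add_increasing)
  qed
  also have "\<dots> = \<bar>u\<bar> * a + 2 * measure \<mu> {x. a \<le> \<bar>x\<bar>}"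
    by (subst Bochner_Integration.integral_add) (use prob_space in \<open>simp_all add: less_top[symmetric]\<close>)
  finally show ?thesis .
qed

text \<open>
The modulus and the argument are changed one after the other; the constant 2 is the price for
estimating them separately.
\<close>

lemma norm_exp_minus_one_le:
  fixes z :: complex
  assumes "Re z \<le> 0"
  shows "norm (exp z - 1) \<le> 2 * norm z"
proof -
  have "exp z = exp (of_real (Re z)) * iexp (Im z)"
    by (metis complex_eq exp_add)
  then have "exp z - 1 = of_real (exp (Re z) - 1) * iexp (Im z) + (iexp (Im z) - 1)"
    by (simp add: algebra_simps exp_of_real)
  also have "norm \<dots> \<le> norm (complex_of_real (exp (Re z) - 1) * iexp (Im z)) + norm (iexp (Im z) - 1)"
    by (rule norm_triangle_ineq)
  also have "norm (complex_of_real (exp (Re z) - 1) * iexp (Im z)) = \<bar>exp (Re z) - 1\<bar>"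
    by (simp only: norm_mult norm_of_real) simp
  also have "\<bar>exp (Re z) - 1\<bar> \<le> \<bar>Re z\<bar>"
    using assms exp_ge_add_one_self[of "Re z"] exp_le_one_iff[of "Re z"] by linarith
  also have "norm (iexp (Im z) - 1) \<le> \<bar>Im z\<bar>"
    using iexp_approx1[of "Im z" 0] by simp
  finally show ?thesis
    using abs_Re_le_cmod[of z] abs_Im_le_cmod[of z] by linarith
qed

lemma norm_iexp_minus_one_minus_le:
  fixes y :: real
  shows "norm (iexp y - 1 - \<i> * y) \<le> 2 * min (y\<^sup>2) \<bar>y\<bar>"
proof -
  have le_abs: "norm (iexp y - 1 - \<i> * y) \<le> 2 * \<bar>y\<bar>"
    using iexp_approx2[of y 1] by (simp add: algebra_simps)
  have "norm (iexp y - 1 - \<i> * y) \<le> y\<^sup>2 / 2"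
    using iexp_approx1[of y 1] by (simp add: algebra_simps power2_eq_square)
  moreover have "y\<^sup>2 \<ge> 0" by simp
  ultimately have "norm (iexp y - 1 - \<i> * y) \<le> 2 * y\<^sup>2" by linarith
  with le_abs show ?thesis by (simp add: min_def)
qed

text \<open>
Multiplying a measure by \<open>1 - cos (\<kappa> * x)\<close> replaces its Fourier transform by a second difference.
This weight vanishes to second order at \<open>0\<close>, so it makes a Levy measure finite, and it is computable from
characteristic functions alone.
\<close>

lemma one_minus_cos_iexp:
  fixes u \<kappa> x :: real
  shows "iexp (u * x) * complex_of_real (1 - cos (\<kappa> * x))
    = iexp (u * x) - (iexp ((u + \<kappa>) * x) + iexp ((u - \<kappa>) * x)) / 2"
  by (rule complex_eqI)
    (simp_all add: Re_exp Im_exp cos_add sin_add cos_diff sin_diff algebra_simps)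

lemma char_second_difference:
  assumes "real_distribution \<mu>"
  shows "char \<mu> u - (char \<mu> (u + \<kappa>) + char \<mu> (u - \<kappa>)) / 2
    = (CLINT x|\<mu>. iexp (u * x) * complex_of_real (1 - cos (\<kappa> * x)))"
proof -
  interpret real_distribution \<mu> by fact
  have int: "integrable \<mu> (\<lambda>x. iexp (u * x))" for u
    by (intro integrable_iexp) simp_all
  have "(CLINT x|\<mu>. iexp (u * x) * complex_of_real (1 - cos (\<kappa> * x)))
     = (CLINT x|\<mu>. iexp (u * x) - (iexp ((u + \<kappa>) * x) + iexp ((u - \<kappa>) * x)) / 2)"
    unfolding one_minus_cos_iexp ..
  also have "\<dots> = (CLINT x|\<mu>. iexp (u * x)) - ((CLINT x|\<mu>. iexp ((u + \<kappa>) * x)) + (CLINT x|\<mu>. iexp ((u - \<kappa>) * x))) / 2"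
    using int[of u] int[of "u + \<kappa>"] int[of "u - \<kappa>"]
    by (simp only: Bochner_Integration.integral_diff Bochner_Integration.integral_add
        integral_divide_zero integrable_divide Bochner_Integration.integrable_add)
  finally show ?thesis unfolding char_def by simp
qed

lemma tendsto_scaled_exp_minus_one:
  fixes z :: complex
  shows "(\<lambda>n. of_nat (Suc n) * (exp (z / of_nat (Suc n)) - 1)) \<longlonglongrightarrow> z"
proof -
  have "((\<lambda>h. exp (z * h)) has_field_derivative z) (at 0)"
    by (auto intro!: derivative_eq_intros)
  then have "((\<lambda>h. (exp (z * h) - 1) / h) \<longlongrightarrow> z) (at 0)"
    by (simp add: has_field_derivative_iff)
  moreover have "filterlim (\<lambda>n. inverse (of_nat (Suc n)) :: complex) (at 0) sequentially"
    unfolding filterlim_at using LIMSEQ_Suc[OF lim_inverse_n, where ?'a1 = complex]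
    by (auto simp del: of_nat_Suc)
  ultimately have "(\<lambda>n. (exp (z * inverse (of_nat (Suc n))) - 1) / inverse (of_nat (Suc n))) \<longlonglongrightarrow> z"
    by (rule filterlim_compose)
  then show ?thesis by (simp add: field_simps del: of_nat_Suc)
qed

section \<open>Levy measures and Levy exponents\<close>

lemma nu_bar_finite:
  assumes "levy_measure \<nu>" "0 < u"
  shows "nu_bar \<nu> u < \<infinity>"
proof -
  have [measurable_cong]: "sets \<nu> = sets borel" and fin: "(\<integral>\<^sup>+x. ennreal (min 1 (x\<^sup>2)) \<partial>\<nu>) < \<infinity>"
    using assms by (auto simp: levy_measure_def)
  define c where "c = min 1 (u\<^sup>2)"
  have c: "c > 0" using assms by (simp add: c_def)
  have "nu_bar \<nu> u = (\<integral>\<^sup>+x. indicator (UNIV - {-u<..<u}) x \<partial>\<nu>)"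
    by (simp add: nu_bar_def)
  also have "\<dots> \<le> (\<integral>\<^sup>+x. ennreal (1 / c) * ennreal (min 1 (x\<^sup>2)) \<partial>\<nu>)"
  proof (intro nn_integral_mono)
    fix x :: real
    show "indicator (UNIV - {-u<..<u}) x \<le> ennreal (1 / c) * ennreal (min 1 (x\<^sup>2))"
    proof (cases "x \<in> UNIV - {-u<..<u}")
      case True
      then have "u \<le> \<bar>x\<bar>" by auto
      then have "u\<^sup>2 \<le> x\<^sup>2" using assms by (simp add: abs_le_square_iff[symmetric])
      then have "c \<le> min 1 (x\<^sup>2)" by (auto simp: c_def)
      then have "1 \<le> 1 / c * min 1 (x\<^sup>2)" using c by (simp add: field_simps)
      then show ?thesis using True c by (simp flip: ennreal_mult')
    qed simp
  qed
  also have "\<dots> < \<infinity>" using fin by (subst nn_integral_cmult) (auto simp: ennreal_mult_less_top)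
  finally show ?thesis .
qed

lemma levy_measure_sigma_finite:
  assumes "levy_measure \<nu>"
  shows "sigma_finite_measure \<nu>"
proof
  have S: "sets \<nu> = sets borel" and z: "emeasure \<nu> {0} = 0"
    using assms by (auto simp: levy_measure_def)
  \<comment> \<open>The sets \<open>A n\<close> exhaust everything but the origin, which is a null set.\<close>
  define A where "A n = UNIV - {- inverse (real (Suc n)) <..< inverse (real (Suc n))}" for n
  have A: "emeasure \<nu> (A n) < \<infinity>" for n
    using nu_bar_finite[OF assms, of "inverse (real (Suc n))"] by (simp add: nu_bar_def A_def)
  have "x \<in> (\<Union>n. A n)" if "x \<noteq> 0" for x :: real
  proof -
    obtain n where "inverse (real (Suc n)) < \<bar>x\<bar>"
      using reals_Archimedean[of "\<bar>x\<bar>"] \<open>x \<noteq> 0\<close> by (auto simp del: of_nat_Suc)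
    then show ?thesis by (intro UN_I[of n]) (auto simp: A_def)
  qed
  then have "(\<Union>n. A n) \<union> {0} = UNIV" by blast
  then show "\<exists>C. countable C \<and> C \<subseteq> sets \<nu> \<and> \<Union> C = space \<nu> \<and> (\<forall>a\<in>C. emeasure \<nu> a \<noteq> \<infinity>)"
    using A z sets_eq_imp_space_eq[OF S]
    by (intro exI[of _ "insert {0} (range A)"]) (auto simp: S A_def less_top)
qed

lemma integrable_min_one_square:
  assumes "levy_measure \<nu>"
  shows "integrable \<nu> (\<lambda>x. min 1 (x\<^sup>2))"
proof (rule integrableI_bounded)
  have [measurable_cong]: "sets \<nu> = sets borel"
    using assms by (auto simp: levy_measure_def)
  show "(\<lambda>x. min 1 (x\<^sup>2)) \<in> borel_measurable \<nu>" by measurable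
  show "(\<integral>\<^sup>+x. ennreal (norm (min 1 (x\<^sup>2))) \<partial>\<nu>) < \<infinity>"
    using assms by (simp add: levy_measure_def min_def)
qed

lemma norm_levy_integrand_le:
  fixes u x :: real
  shows "norm (iexp (u * x) - 1 - \<i> * complex_of_real (u * x * indicator {-1<..<1} x))
    \<le> 2 * (min ((u * x)\<^sup>2) \<bar>u * x\<bar> * indicator {-1<..<1} x + indicator (UNIV - {-1<..<1}) x)"
proof (cases "x \<in> {-1<..<1}")
  case True
  then show ?thesis using norm_iexp_minus_one_minus_le[of "u * x"] by simp
next
  case False
  then show ?thesis using norm_triangle_ineq4[of "iexp (u * x)" 1] by simp
qed

lemma integrable_levy_integrand:
  assumes "levy_measure \<nu>"
  shows "integrable \<nu> (\<lambda>x. iexp (u * x) - 1 - \<i> * complex_of_real (u * x * indicator {-1<..<1} x))"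
proof (rule Bochner_Integration.integrable_bound)
  have [measurable_cong]: "sets \<nu> = sets borel"
    using assms by (auto simp: levy_measure_def)
  show "integrable \<nu> (\<lambda>x. 2 * (1 + u\<^sup>2) * min 1 (x\<^sup>2))"
    using integrable_min_one_square[OF assms] by simp
  show "(\<lambda>x. iexp (u * x) - 1 - \<i> * complex_of_real (u * x * indicator {-1<..<1} x)) \<in> borel_measurable \<nu>"
    by measurable
  show "AE x in \<nu>. norm (iexp (u * x) - 1 - \<i> * complex_of_real (u * x * indicator {-1<..<1} x))
    \<le> norm (2 * (1 + u\<^sup>2) * min 1 (x\<^sup>2))"
  proof (intro always_eventually allI)
    fix x :: real
    have "min ((u * x)\<^sup>2) \<bar>u * x\<bar> * indicator {-1<..<1} x + indicator (UNIV - {-1<..<1}) x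
      \<le> (1 + u\<^sup>2) * min 1 (x\<^sup>2)"
    proof (cases "x \<in> {-1<..<1}")
      case True
      then have "x\<^sup>2 \<le> 1" by (simp add: abs_square_le_1 abs_le_iff)
      then have "min 1 (x\<^sup>2) = x\<^sup>2" by simp
      moreover have "min ((u * x)\<^sup>2) \<bar>u * x\<bar> \<le> u\<^sup>2 * x\<^sup>2" by (simp add: power_mult_distrib min_le_iff_disj)
      ultimately show ?thesis using True by (simp add: algebra_simps add_increasing)
    next
      case False
      then have "1 \<le> x\<^sup>2" using abs_le_square_iff[of 1 x] by auto
      then show ?thesis using False by (simp add: min_def)
    qed
    then have "2 * (min ((u * x)\<^sup>2) \<bar>u * x\<bar> * indicator {-1<..<1} x + indicator (UNIV - {-1<..<1}) x)
      \<le> 2 * ((1 + u\<^sup>2) * min 1 (x\<^sup>2))"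
      by (rule mult_left_mono) simp
    also have "\<dots> \<le> norm (2 * (1 + u\<^sup>2) * min 1 (x\<^sup>2))"
      unfolding mult.assoc real_norm_def by (rule abs_ge_self)
    finally show "norm (iexp (u * x) - 1 - \<i> * complex_of_real (u * x * indicator {-1<..<1} x))
      \<le> norm (2 * (1 + u\<^sup>2) * min 1 (x\<^sup>2))"
      by (rule order_trans[OF norm_levy_integrand_le])
  qed
qed

text \<open>
The drift and the compensator are purely imaginary.
\<close>

lemma Re_levy_exponent:
  assumes "levy_measure \<nu>"
  shows "integrable \<nu> (\<lambda>x. 1 - cos (u * x))"
    and "Re (levy_exponent \<gamma> 0 \<nu> u) = - (LINT x|\<nu>. 1 - cos (u * x))"
proof -
  let ?k = "\<lambda>x. iexp (u * x) - 1 - \<i> * complex_of_real (u * x * indicator {-1<..<1} x)"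
  have Re: "Re (?k x) = - (1 - cos (u * x))" for x
    by (simp add: Re_exp)
  have "integrable \<nu> (\<lambda>x. - Re (?k x))"
    using integrable_levy_integrand[OF assms, of u] by (intro integrable_minus integrable_Re)
  then show "integrable \<nu> (\<lambda>x. 1 - cos (u * x))" unfolding Re by simp
  have "Re (CLINT x|\<nu>. ?k x) = (LINT x|\<nu>. Re (?k x))"
    by (rule integral_Re[OF integrable_levy_integrand[OF assms], symmetric])
  then show "Re (levy_exponent \<gamma> 0 \<nu> u) = - (LINT x|\<nu>. 1 - cos (u * x))"
    unfolding Re levy_exponent_def by (simp flip: Bochner_Integration.integral_minus)
qed

lemma nn_integral_one_minus_cos:
  assumes "levy_measure \<nu>"
  shows "(\<integral>\<^sup>+x. ennreal (1 - cos (u * x)) \<partial>\<nu>) = ennreal (- Re (levy_exponent \<gamma> 0 \<nu> u))"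
  using nn_integral_eq_integral[OF Re_levy_exponent(1)[OF assms, of u]]
  by (simp add: Re_levy_exponent(2)[OF assms])

text \<open>
The drift and the compensator are affine in \<open>u\<close>, hence invisible to the second difference.
\<close>

lemma levy_exponent_second_difference:
  assumes "levy_measure \<nu>"
  shows "levy_exponent \<gamma> 0 \<nu> u - (levy_exponent \<gamma> 0 \<nu> (u + \<kappa>) + levy_exponent \<gamma> 0 \<nu> (u - \<kappa>)) / 2
    = (CLINT x|\<nu>. iexp (u * x) * complex_of_real (1 - cos (\<kappa> * x)))"
proof -
  let ?k = "\<lambda>u x. iexp (u * x) - 1 - \<i> * complex_of_real (u * x * indicator {-1<..<1} x)"
  note int = integrable_levy_integrand[OF assms]
  have "iexp (u * x) * complex_of_real (1 - cos (\<kappa> * x)) = ?k u x - (?k (u + \<kappa>) x + ?k (u - \<kappa>) x) / 2" for x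
    unfolding one_minus_cos_iexp by (simp add: field_simps)
  then have "(CLINT x|\<nu>. iexp (u * x) * complex_of_real (1 - cos (\<kappa> * x)))
     = (CLINT x|\<nu>. ?k u x - (?k (u + \<kappa>) x + ?k (u - \<kappa>) x) / 2)"
    by presburger
  also have "\<dots> = (CLINT x|\<nu>. ?k u x) - ((CLINT x|\<nu>. ?k (u + \<kappa>) x) + (CLINT x|\<nu>. ?k (u - \<kappa>) x)) / 2"
    using int[of u] int[of "u + \<kappa>"] int[of "u - \<kappa>"]
    by (simp only: Bochner_Integration.integral_diff Bochner_Integration.integral_add
        integral_divide_zero integrable_divide Bochner_Integration.integrable_add)
  finally show ?thesis unfolding levy_exponent_def by (simp add: field_simps)
qed

text \<open>
A bound for \<open>\<bar>\<psi> v\<bar>\<close> that is uniform over \<open>\<bar>v\<bar> \<le> \<bar>u\<bar>\<close>: drift, compensated small jumps and large jumps,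
with \<open>\<sigma> = 0\<close>.
\<close>

definition levy_growth :: "real \<Rightarrow> real measure \<Rightarrow> real \<Rightarrow> ennreal" where
  "levy_growth \<gamma> \<nu> u = ennreal \<bar>\<gamma> * u\<bar>
    + 2 * ((\<integral>\<^sup>+x\<in>{-1<..<1}. ennreal (min ((u * x)\<^sup>2) \<bar>u * x\<bar>) \<partial>\<nu>) + nu_bar \<nu> 1)"

lemma levy_growth_mono:
  assumes "\<bar>u\<bar> \<le> \<bar>v\<bar>"
  shows "levy_growth \<gamma> \<nu> u \<le> levy_growth \<gamma> \<nu> v"
proof -
  have "min ((u * x)\<^sup>2) \<bar>u * x\<bar> \<le> min ((v * x)\<^sup>2) \<bar>v * x\<bar>" for x
  proof -
    have "\<bar>u * x\<bar> \<le> \<bar>v * x\<bar>" using assms by (simp add: abs_mult mult_right_mono)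
    then show ?thesis by (meson abs_le_square_iff min.mono)
  qed
  then show ?thesis
    unfolding levy_growth_def using assms
    by (intro add_mono mult_left_mono nn_integral_mono mult_right_mono ennreal_leI)
      (auto simp: abs_mult intro: mult_left_mono)
qed

lemma levy_growth_finite:
  assumes "levy_measure \<nu>"
  shows "levy_growth \<gamma> \<nu> u < \<infinity>"
proof -
  have [measurable_cong]: "sets \<nu> = sets borel" and fin: "(\<integral>\<^sup>+x. ennreal (min 1 (x\<^sup>2)) \<partial>\<nu>) < \<infinity>"
    using assms by (auto simp: levy_measure_def)
  have "(\<integral>\<^sup>+x\<in>{-1<..<1}. ennreal (min ((u * x)\<^sup>2) \<bar>u * x\<bar>) \<partial>\<nu>)
    \<le> (\<integral>\<^sup>+x. ennreal (u\<^sup>2) * ennreal (min 1 (x\<^sup>2)) \<partial>\<nu>)"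
  proof (intro nn_integral_mono)
    fix x :: real
    show "ennreal (min ((u * x)\<^sup>2) \<bar>u * x\<bar>) * indicator {-1<..<1} x \<le> ennreal (u\<^sup>2) * ennreal (min 1 (x\<^sup>2))"
    proof (cases "x \<in> {-1<..<1}")
      case True
      then have "x\<^sup>2 \<le> 1" by (simp add: abs_square_le_1 abs_le_iff)
      then have "min ((u * x)\<^sup>2) \<bar>u * x\<bar> \<le> u\<^sup>2 * min 1 (x\<^sup>2)"
        by (simp add: power_mult_distrib min_le_iff_disj)
      then show ?thesis using True by (simp add: ennreal_leI flip: ennreal_mult')
    qed simp
  qed
  also have "\<dots> = ennreal (u\<^sup>2) * (\<integral>\<^sup>+x. ennreal (min 1 (x\<^sup>2)) \<partial>\<nu>)"
    by (intro nn_integral_cmult) measurable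
  also have "\<dots> < \<infinity>" using fin by (simp add: ennreal_mult_less_top)
  finally show ?thesis
    using nu_bar_finite[OF assms, of 1]
    by (simp add: levy_growth_def ennreal_mult_less_top)
qed

lemma norm_levy_exponent_le:
  assumes "levy_measure \<nu>"
  shows "ennreal (norm (levy_exponent \<gamma> 0 \<nu> u)) \<le> ennreal \<bar>\<gamma> * u\<bar>
    + 2 * ((\<integral>\<^sup>+x\<in>{-1<..<1}. ennreal (min ((u * x)\<^sup>2) \<bar>u * x\<bar>) \<partial>\<nu>) + nu_bar \<nu> 1)"
proof -
  have [measurable_cong]: "sets \<nu> = sets borel"
    using assms by (auto simp: levy_measure_def)
  let ?k = "\<lambda>x. iexp (u * x) - 1 - \<i> * complex_of_real (u * x * indicator {-1<..<1} x)"
  have "norm (levy_exponent \<gamma> 0 \<nu> u) \<le> \<bar>\<gamma> * u\<bar> + norm (CLINT x|\<nu>. ?k x)"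
    unfolding levy_exponent_def by (rule order_trans[OF norm_triangle_ineq]) (simp add: norm_mult abs_mult)
  then have "ennreal (norm (levy_exponent \<gamma> 0 \<nu> u)) \<le> ennreal \<bar>\<gamma> * u\<bar> + ennreal (norm (CLINT x|\<nu>. ?k x))"
    by (simp add: ennreal_leI flip: ennreal_plus)
  also have "ennreal (norm (CLINT x|\<nu>. ?k x)) \<le> (\<integral>\<^sup>+x. norm (?k x) \<partial>\<nu>)"
    by (intro integral_norm_bound_ennreal integrable_levy_integrand assms)
  also have "\<dots> \<le> (\<integral>\<^sup>+x. 2 * (ennreal (min ((u * x)\<^sup>2) \<bar>u * x\<bar>) * indicator {-1<..<1} x
      + indicator (UNIV - {-1<..<1}) x) \<partial>\<nu>)"
  proof (intro nn_integral_mono)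
    fix x :: real
    have "ennreal (norm (?k x)) \<le> ennreal (2 * (min ((u * x)\<^sup>2) \<bar>u * x\<bar> * indicator {-1<..<1} x
      + indicator (UNIV - {-1<..<1}) x))"
      by (intro ennreal_leI norm_levy_integrand_le)
    also have "\<dots> = 2 * (ennreal (min ((u * x)\<^sup>2) \<bar>u * x\<bar>) * indicator {-1<..<1} x
      + indicator (UNIV - {-1<..<1}) x)"
      by (cases "x \<in> {-1<..<1}") (simp_all add: ennreal_mult')
    finally show "ennreal (norm (?k x)) \<le> \<dots>" .
  qed
  also have "\<dots> = 2 * ((\<integral>\<^sup>+x\<in>{-1<..<1}. ennreal (min ((u * x)\<^sup>2) \<bar>u * x\<bar>) \<partial>\<nu>) + nu_bar \<nu> 1)"
    by (simp add: nn_integral_cmult nn_integral_add nu_bar_def)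
  finally show ?thesis by (simp add: add_left_mono)
qed

text \<open>
Since \<open>Re (1 - exp (t * \<psi>)) \<le> 2 * t * \<bar>\<psi>\<bar>\<close>, the truncated second moment at a fixed scale
grows at most linearly in \<open>t\<close>.
\<close>

lemma truncated_second_moment_le_levy_growth:
  fixes \<mu> :: "real measure" and t u :: real
  assumes \<nu>: "levy_measure \<nu>" and \<mu>: "real_distribution \<mu>" and t: "0 \<le> t"
    and char: "\<And>u. char \<mu> u = exp (complex_of_real t * levy_exponent \<gamma> 0 \<nu> u)"
  shows "(\<integral>\<^sup>+x. ennreal (min 1 ((u * x)\<^sup>2)) \<partial>\<mu>) \<le> 16 * (ennreal t * levy_growth \<gamma> \<nu> u)"
proof -
  interpret real_distribution \<mu> by fact
  let ?\<psi> = "levy_exponent \<gamma> 0 \<nu>"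
  have "(\<integral>\<^sup>+x. ennreal (min 1 ((u * x)\<^sup>2)) \<partial>\<mu>) \<le> 8 * (2 * (ennreal t * levy_growth \<gamma> \<nu> u))"
  proof (rule truncated_second_moment_le)
    fix s :: real assume s: "s \<in> {0..1}"
    define v where "v = s * u"
    have int: "integrable \<mu> (\<lambda>x. iexp (v * x))" by (intro integrable_iexp) simp_all
    have "(\<integral>\<^sup>+x. ennreal (1 - cos (v * x)) \<partial>\<mu>) = ennreal (LINT x|\<mu>. 1 - cos (v * x))"
      by (intro nn_integral_eq_integral integrable_const_bound[where B = 2])
        (auto simp: abs_le_iff intro: order_trans[OF cos_le_one])
    also have "(LINT x|\<mu>. 1 - cos (v * x)) = (LINT x|\<mu>. Re (1 - iexp (v * x)))"
      by (simp add: Re_exp)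
    also have "\<dots> = Re (CLINT x|\<mu>. 1 - iexp (v * x))"
      using int by (intro integral_Re) simp
    also have "(CLINT x|\<mu>. 1 - iexp (v * x)) = 1 - char \<mu> v"
      using int prob_space unfolding char_def by simp
    also have "Re (1 - char \<mu> v) \<le> norm (exp (complex_of_real t * ?\<psi> v) - 1)"
      unfolding char norm_minus_commute[of "exp _"] by (rule complex_Re_le_cmod)
    also have "\<dots> \<le> 2 * norm (complex_of_real t * ?\<psi> v)"
      using cmod_char_le_1[of v] unfolding char by (intro norm_exp_minus_one_le) simp
    also have "\<dots> = 2 * (t * norm (?\<psi> v))" using t by (simp add: norm_mult)
    also have "ennreal (2 * (t * norm (?\<psi> v))) = 2 * (ennreal t * ennreal (norm (?\<psi> v)))"
      using t by (simp add: ennreal_mult')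
    also have "ennreal (norm (?\<psi> v)) \<le> levy_growth \<gamma> \<nu> v"
      unfolding levy_growth_def by (rule norm_levy_exponent_le[OF \<nu>])
    also have "\<dots> \<le> levy_growth \<gamma> \<nu> u"
      using s by (intro levy_growth_mono) (auto simp: v_def abs_mult intro: mult_left_le_one_le)
    finally show "(\<integral>\<^sup>+x. ennreal (1 - cos (s * u * x)) \<partial>\<mu>) \<le> 2 * (ennreal t * levy_growth \<gamma> \<nu> u)"
      by (simp add: v_def ennreal_leI mult_left_mono)
  qed (simp_all add: sigma_finite_measure_axioms)
  then show ?thesis by (simp flip: mult.assoc)
qed

section \<open>The small-time limit of the marginal laws\<close>

text \<open>
Levy's continuity theorem for finite measures given by densities \<open>w n\<close> and \<open>v\<close>. The total masses converge
(take \<open>u = 0\<close>), so the measures can be normalised to probability measures unless the limit is null;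
in that case the integrals tend to \<open>0\<close> together with the masses.
\<close>

lemma levy_continuity_weighted:
  fixes \<mu> :: "nat \<Rightarrow> real measure" and \<nu> :: "real measure" and w :: "nat \<Rightarrow> real \<Rightarrow> real" and v h :: "real \<Rightarrow> real"
  assumes sets_\<mu>: "\<And>n. sets (\<mu> n) = sets borel" and sets_\<nu>: "sets \<nu> = sets borel"
    and w_nonneg: "\<And>n x. 0 \<le> w n x" and w_int: "\<And>n. integrable (\<mu> n) (w n)"
    and v_nonneg: "\<And>x. 0 \<le> v x" and v_int: "integrable \<nu> v"
    and conv: "\<And>u. (\<lambda>n. CLINT x|\<mu> n. iexp (u * x) * complex_of_real (w n x))
        \<longlonglongrightarrow> (CLINT x|\<nu>. iexp (u * x) * complex_of_real (v x))"
    and h_cont: "\<And>x. isCont h x" and h_bound: "\<And>x. \<bar>h x\<bar> \<le> B"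
  shows "(\<lambda>n. LINT x|\<mu> n. w n x * h x) \<longlonglongrightarrow> (LINT x|\<nu>. v x * h x)"
proof -
  have h_meas: "h \<in> borel_measurable borel"
    using h_cont by (intro borel_measurable_continuous_onI continuous_at_imp_continuous_on) auto
  define c where "c n = (LINT x|\<mu> n. w n x)" for n
  define d where "d = (LINT x|\<nu>. v x)"
  have c_lim: "c \<longlonglongrightarrow> d"
    using tendsto_Re[OF conv[of 0]] unfolding c_def[abs_def] d_def by simp
  have d_nonneg: "d \<ge> 0" using v_nonneg by (simp add: d_def)
  show ?thesis
  proof (cases "d = 0")
    case True
    have "AE x in \<nu>. v x = 0"
      using integral_nonneg_eq_0_iff_AE[OF v_int] v_nonneg True by (simp add: d_def)
    then have "(LINT x|\<nu>. v x * h x) = 0"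
      by (intro integral_eq_zero_AE) auto
    moreover have "(\<lambda>n. LINT x|\<mu> n. w n x * h x) \<longlonglongrightarrow> 0"
    proof (rule Lim_null_comparison)
      show "(\<lambda>n. c n * B) \<longlonglongrightarrow> 0"
        using tendsto_mult_right[OF c_lim, of B] True by simp
      show "\<forall>\<^sub>F n in sequentially. norm (LINT x|\<mu> n. w n x * h x) \<le> c n * B"
      proof (intro always_eventually allI)
        fix n
        have "norm (LINT x|\<mu> n. w n x * h x) \<le> (LINT x|\<mu> n. norm (w n x * h x))"
          by (rule integral_norm_bound)
        also have "\<dots> \<le> (LINT x|\<mu> n. w n x * B)"
        proof (rule Bochner_Integration.integral_mono)
          have [measurable]: "h \<in> borel_measurable (\<mu> n)" "w n \<in> borel_measurable (\<mu> n)"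
            using borel_measurable_integrable[OF w_int] h_meas
            by (simp_all add: measurable_cong_sets[OF sets_\<mu> refl])
          have le: "norm (w n x * h x) \<le> w n x * B" for x
            unfolding real_norm_def abs_mult using w_nonneg[of n x] h_bound[of x]
            by (simp add: mult_left_mono)
          then show "norm (w n x * h x) \<le> w n x * B" for x .
          show wB: "integrable (\<mu> n) (\<lambda>x. w n x * B)" using w_int[of n] by simp
          have "AE x in \<mu> n. norm (w n x * h x) \<le> norm (w n x * B)"
            using order_trans[OF le abs_ge_self] by simp
          then have "integrable (\<mu> n) (\<lambda>x. w n x * h x)"
            by (intro Bochner_Integration.integrable_bound[OF wB]) simp_all
          then show "integrable (\<mu> n) (\<lambda>x. norm (w n x * h x))"
            by (rule integrable_norm)
        qed
        finally show "norm (LINT x|\<mu> n. w n x * h x) \<le> c n * B"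
          by (simp add: c_def)
      qed
    qed
    ultimately show ?thesis by simp
  next
    case False
    then have "d > 0" using d_nonneg by simp
    then obtain N where N: "\<And>n. n \<ge> N \<Longrightarrow> c n > 0"
      using order_tendstoD(1)[OF c_lim] by (auto simp: eventually_sequentially)
    \<comment> \<open>The first \<open>N\<close> measures may be null and cannot be normalised.\<close>
    define P where "P n = density (\<mu> (n + N)) (\<lambda>x. w (n + N) x / c (n + N))" for n
    define Q where "Q = density \<nu> (\<lambda>x. v x / d)"
    have prob: "real_distribution (density \<rho> (\<lambda>x. ennreal (f x / a)))"
      if "sets \<rho> = sets borel" "integrable \<rho> f" "\<And>x. 0 \<le> f x" "a = (LINT x|\<rho>. f x)" "a > 0"
      for \<rho> :: "real measure" and f :: "real \<Rightarrow> real" and a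
    proof -
      have sp: "space \<rho> = UNIV" using sets_eq_imp_space_eq[OF that(1)] by simp
      have [measurable]: "f \<in> borel_measurable \<rho>" using that(2) by simp
      have "emeasure (density \<rho> (\<lambda>x. ennreal (f x / a))) UNIV = (\<integral>\<^sup>+x. ennreal (f x / a) \<partial>\<rho>)"
        using that(1) sp by (simp add: emeasure_density)
      also have "\<dots> = ennreal (LINT x|\<rho>. f x / a)"
        using that by (intro nn_integral_eq_integral) auto
      also have "\<dots> = 1" using that by simp
      finally have "prob_space (density \<rho> (\<lambda>x. ennreal (f x / a)))"
        by (intro prob_spaceI) (simp add: sp)
      then show ?thesis
        using that(1) sp by (simp add: real_distribution_def real_distribution_axioms_def)
    qed
    have int: "(LINT x|density \<rho> (\<lambda>x. ennreal (f x / a)). g x) = (LINT x|\<rho>. f x * g x) / a"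
      if "sets \<rho> = sets borel" "integrable \<rho> f" "\<And>x. 0 \<le> f x" "a > 0" "g \<in> borel_measurable borel"
      for \<rho> :: "real measure" and f g :: "real \<Rightarrow> real" and a
    proof -
      have [measurable]: "f \<in> borel_measurable \<rho>" "g \<in> borel_measurable \<rho>"
        using that by (auto simp: measurable_cong_sets[OF that(1) refl])
      show ?thesis using that by (subst integral_density) auto
    qed
    have char: "char (density \<rho> (\<lambda>x. ennreal (f x / a))) u
        = (CLINT x|\<rho>. iexp (u * x) * complex_of_real (f x)) / of_real a"
      if "sets \<rho> = sets borel" "integrable \<rho> f" "\<And>x. 0 \<le> f x" "a > 0"
      for \<rho> :: "real measure" and f :: "real \<Rightarrow> real" and a u
    proof -
      have [measurable]: "f \<in> borel_measurable \<rho>" "(\<lambda>x. iexp (u * x)) \<in> borel_measurable \<rho>"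
        using that by (auto simp: measurable_cong_sets[OF that(1) refl])
      have "char (density \<rho> (\<lambda>x. ennreal (f x / a))) u = (CLINT x|\<rho>. (f x / a) *\<^sub>R iexp (u * x))"
        unfolding char_def using that by (subst integral_density) auto
      also have "\<dots> = (CLINT x|\<rho>. (iexp (u * x) * complex_of_real (f x)) / of_real a)"
        by (intro Bochner_Integration.integral_cong) (simp_all add: scaleR_conv_of_real)
      also have "\<dots> = (CLINT x|\<rho>. iexp (u * x) * complex_of_real (f x)) / of_real a"
        by (rule integral_divide_zero)
      finally show ?thesis .
    qed
    have P: "real_distribution (P n)" for n
      unfolding P_def by (intro prob sets_\<mu> w_int w_nonneg N c_def) simp
    have Q: "real_distribution Q"
      unfolding Q_def by (intro prob sets_\<nu> v_int v_nonneg d_def \<open>d > 0\<close>)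
    have c_lim': "(\<lambda>n. c (n + N)) \<longlonglongrightarrow> d" by (rule LIMSEQ_ignore_initial_segment[OF c_lim])
    have "(\<lambda>n. char (P n) u) \<longlonglongrightarrow> char Q u" for u
      unfolding P_def Q_def
      by (subst (1 2) char; (intro sets_\<mu> sets_\<nu> w_int w_nonneg v_int v_nonneg N \<open>d > 0\<close> le_add2)?)
         (intro tendsto_divide LIMSEQ_ignore_initial_segment[OF conv[of u]] tendsto_of_real c_lim', use False in simp)
    then have "weak_conv_m P Q"
      by (intro levy_continuity P Q)
    then have "(\<lambda>n. LINT x|P n. h x) \<longlonglongrightarrow> (LINT x|Q. h x)"
      using P Q h_cont h_bound
      by (intro weak_conv_imp_integral_bdd_continuous_conv[where B = B]) auto
    then have "(\<lambda>n. (LINT x|\<mu> (n + N). w (n + N) x * h x) / c (n + N)) \<longlonglongrightarrow> (LINT x|\<nu>. v x * h x) / d"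
      unfolding P_def Q_def
      by (simp add: int sets_\<mu> sets_\<nu> w_int w_nonneg v_int v_nonneg N \<open>d > 0\<close> h_meas)
    from tendsto_mult[OF this c_lim']
    have "(\<lambda>n. LINT x|\<mu> (n + N). w (n + N) x * h x) \<longlonglongrightarrow> (LINT x|\<nu>. v x * h x)"
      using N \<open>d > 0\<close> by (simp add: less_imp_neq[THEN not_sym])
    then show ?thesis by (rule LIMSEQ_offset)
  qed
qed

text \<open>
With \<open>n + 1\<close> in place of \<open>n\<close>, the second difference of \<open>n * (exp (t * \<psi> / n) - 1)\<close> converges to that of
\<open>t * \<psi>\<close>, so the Fourier transforms of the weighted measures converge.
\<close>

lemma levy_small_time_limit_weighted:
  fixes \<mu> :: "nat \<Rightarrow> real measure" and \<kappa> t :: real and h :: "real \<Rightarrow> real"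
  assumes \<nu>: "levy_measure \<nu>" and \<mu>: "\<And>n. real_distribution (\<mu> n)" and t: "0 \<le> t"
    and char: "\<And>n u. char (\<mu> n) u = exp (complex_of_real (t / Suc n) * levy_exponent \<gamma> 0 \<nu> u)"
    and h_cont: "\<And>x. isCont h x" and h_bound: "\<And>x. \<bar>h x\<bar> \<le> B"
  shows "(\<lambda>n. Suc n * (LINT x|\<mu> n. (1 - cos (\<kappa> * x)) * h x))
    \<longlonglongrightarrow> t * (LINT x|\<nu>. (1 - cos (\<kappa> * x)) * h x)"
proof -
  interpret \<mu>: real_distribution "\<mu> n" for n by (rule \<mu>)
  have sets_\<nu>: "sets \<nu> = sets borel" using \<nu> by (simp add: levy_measure_def)
  let ?\<psi> = "levy_exponent \<gamma> 0 \<nu>"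
  have lim: "(\<lambda>n. of_nat (Suc n) * (char (\<mu> n) u - 1)) \<longlonglongrightarrow> complex_of_real t * ?\<psi> u" for u
    using tendsto_scaled_exp_minus_one[of "complex_of_real t * ?\<psi> u"] by (simp add: char del: of_nat_Suc)
  have "(\<lambda>n. LINT x|\<mu> n. (Suc n * (1 - cos (\<kappa> * x))) * h x) \<longlonglongrightarrow> (LINT x|\<nu>. (t * (1 - cos (\<kappa> * x))) * h x)"
  proof (rule levy_continuity_weighted[OF _ sets_\<nu> _ _ _ _ _ h_cont h_bound])
    show "sets (\<mu> n) = sets borel" for n by simp
    show "integrable (\<mu> n) (\<lambda>x. Suc n * (1 - cos (\<kappa> * x)))" for n
      by (intro integrable_mult_right \<mu>.integrable_const_bound[where B = 2])
        (auto simp: abs_le_iff intro: order_trans[OF cos_le_one])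
    show "integrable \<nu> (\<lambda>x. t * (1 - cos (\<kappa> * x)))"
      by (intro integrable_mult_right Re_levy_exponent(1)[OF \<nu>])
    fix u
    have "complex_of_real (real (Suc n)) * (CLINT x|\<mu> n. iexp (u * x) * complex_of_real (1 - cos (\<kappa> * x)))
      = of_nat (Suc n) * (char (\<mu> n) u - 1)
        - (of_nat (Suc n) * (char (\<mu> n) (u + \<kappa>) - 1) + of_nat (Suc n) * (char (\<mu> n) (u - \<kappa>) - 1)) / 2" for n
      unfolding char_second_difference[OF \<mu>, symmetric] of_real_of_nat_eq by (simp add: field_simps)
    moreover have "(\<lambda>n. of_nat (Suc n) * (char (\<mu> n) u - 1)
        - (of_nat (Suc n) * (char (\<mu> n) (u + \<kappa>) - 1) + of_nat (Suc n) * (char (\<mu> n) (u - \<kappa>) - 1)) / 2)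
      \<longlonglongrightarrow> of_real t * ?\<psi> u - (of_real t * ?\<psi> (u + \<kappa>) + of_real t * ?\<psi> (u - \<kappa>)) / 2"
      by (intro tendsto_intros lim) simp
    moreover have "of_real t * ?\<psi> u - (of_real t * ?\<psi> (u + \<kappa>) + of_real t * ?\<psi> (u - \<kappa>)) / 2
      = of_real t * (CLINT x|\<nu>. iexp (u * x) * complex_of_real (1 - cos (\<kappa> * x)))"
      unfolding levy_exponent_second_difference[OF \<nu>, of \<gamma>, symmetric] by (simp add: field_simps)
    ultimately have lim': "(\<lambda>n. complex_of_real (real (Suc n)) * (CLINT x|\<mu> n. iexp (u * x) * complex_of_real (1 - cos (\<kappa> * x))))
      \<longlonglongrightarrow> of_real t * (CLINT x|\<nu>. iexp (u * x) * complex_of_real (1 - cos (\<kappa> * x)))"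
      by (simp only:)
    have pull: "(CLINT x|\<rho>. iexp (u * x) * complex_of_real (a * (1 - cos (\<kappa> * x))))
      = of_real a * (CLINT x|\<rho>. iexp (u * x) * complex_of_real (1 - cos (\<kappa> * x)))" for a :: real and \<rho> :: "real measure"
      unfolding integral_mult_right_zero[symmetric]
      by (intro Bochner_Integration.integral_cong refl) (simp only: of_real_mult mult.left_commute)
    show "(\<lambda>n. CLINT x|\<mu> n. iexp (u * x) * complex_of_real (Suc n * (1 - cos (\<kappa> * x))))
      \<longlonglongrightarrow> (CLINT x|\<nu>. iexp (u * x) * complex_of_real (t * (1 - cos (\<kappa> * x))))"
      unfolding pull by (rule lim')
  qed (use t in simp_all)
  then show ?thesis by (simp only: mult.assoc integral_mult_right_zero)
qed

text \<open>
A continuous cutoff: it equals \<open>1\<close> on \<open>2 * \<alpha> \<le> \<bar>x\<bar> \<le> \<rho>\<close> and vanishes outside \<open>\<alpha> \<le> \<bar>x\<bar> \<le> 2 * \<rho>\<close>. Test functions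
have to be continuous for weak convergence, and their supports have to avoid the zeros of the weight
\<open>1 - cos (\<kappa> * x)\<close>, which confines them to an annulus.
\<close>

definition annulus_bump :: "real \<Rightarrow> real \<Rightarrow> real \<Rightarrow> real" where
  "annulus_bump \<alpha> \<rho> x = max 0 (min 1 (min (\<bar>x\<bar> / \<alpha> - 1) (2 - \<bar>x\<bar> / \<rho>)))"

lemma annulus_bump_bounds:
  "0 \<le> annulus_bump \<alpha> \<rho> x" "annulus_bump \<alpha> \<rho> x \<le> 1"
  by (auto simp: annulus_bump_def)

lemma annulus_bump_eq_1:
  assumes "0 < \<alpha>" "0 < \<rho>" "2 * \<alpha> \<le> \<bar>x\<bar>" "\<bar>x\<bar> \<le> \<rho>"
  shows "annulus_bump \<alpha> \<rho> x = 1"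
proof -
  have "2 \<le> \<bar>x\<bar> / \<alpha>" "\<bar>x\<bar> / \<rho> \<le> 1" using assms by (simp_all add: field_simps)
  then show ?thesis unfolding annulus_bump_def by simp
qed

lemma annulus_bump_eq_0:
  assumes "0 < \<alpha>" "0 < \<rho>" "\<bar>x\<bar> < \<alpha> \<or> 2 * \<rho> < \<bar>x\<bar>"
  shows "annulus_bump \<alpha> \<rho> x = 0"
proof -
  have "\<bar>x\<bar> / \<alpha> \<le> 1 \<or> 2 \<le> \<bar>x\<bar> / \<rho>" using assms by (auto simp add: field_simps)
  then show ?thesis unfolding annulus_bump_def by auto
qed

lemma annulus_bump_le_indicator:
  assumes "0 < \<alpha>" "0 < \<rho>" "\<And>x. \<alpha> \<le> \<bar>x\<bar> \<Longrightarrow> \<bar>x\<bar> \<le> 2 * \<rho> \<Longrightarrow> x \<in> S"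
  shows "annulus_bump \<alpha> \<rho> x \<le> indicator S x"
proof (cases "x \<in> S")
  case True
  then show ?thesis by (simp add: annulus_bump_bounds)
next
  case False
  then have "\<bar>x\<bar> < \<alpha> \<or> 2 * \<rho> < \<bar>x\<bar>" using assms(3)[of x] by force
  then show ?thesis using annulus_bump_eq_0[OF assms(1,2)] by simp
qed

lemma indicator_le_annulus_bump:
  assumes "0 < \<alpha>" "0 < \<rho>" "\<And>x. x \<in> S \<Longrightarrow> 2 * \<alpha> \<le> \<bar>x\<bar> \<and> \<bar>x\<bar> \<le> \<rho>"
  shows "indicator S x \<le> annulus_bump \<alpha> \<rho> x"
  using assms annulus_bump_eq_1[of \<alpha> \<rho> x] annulus_bump_bounds[of \<alpha> \<rho> x]
  by (cases "x \<in> S") auto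

lemma borel_measurable_annulus_bump [measurable]: "annulus_bump \<alpha> \<rho> \<in> borel_measurable borel"
  unfolding annulus_bump_def[abs_def] by measurable

text \<open>
The weight \<open>1 - cos (\<kappa> * x)\<close> is divided out. With \<open>\<kappa> = pi / (2 * \<rho>)\<close> the support of the bump lies in
\<open>\<kappa> * \<alpha> \<le> \<bar>\<kappa> * x\<bar> \<le> pi\<close>, where the weight is bounded below by its value at \<open>\<alpha>\<close>.
\<close>

lemma levy_small_time_limit:
  fixes \<mu> :: "nat \<Rightarrow> real measure" and t \<alpha> \<rho> :: real
  assumes \<nu>: "levy_measure \<nu>" and \<mu>: "\<And>n. real_distribution (\<mu> n)" and t: "0 \<le> t"
    and char: "\<And>n u. char (\<mu> n) u = exp (complex_of_real (t / Suc n) * levy_exponent \<gamma> 0 \<nu> u)"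
    and \<alpha>: "0 < \<alpha>" "\<alpha> \<le> \<rho>"
  shows "(\<lambda>n. Suc n * (LINT x|\<mu> n. annulus_bump \<alpha> \<rho> x)) \<longlonglongrightarrow> t * (LINT x|\<nu>. annulus_bump \<alpha> \<rho> x)"
proof -
  define \<kappa> where "\<kappa> = pi / (2 * \<rho>)"
  define m where "m = 1 - cos (\<kappa> * \<alpha>)"
  have \<rho>: "\<rho> > 0" and \<kappa>: "\<kappa> > 0" using \<alpha> by (simp_all add: \<kappa>_def)
  have \<kappa>\<alpha>: "0 < \<kappa> * \<alpha>" "\<kappa> * \<alpha> \<le> pi"
    using \<alpha> \<rho> by (simp_all add: \<kappa>_def field_simps)
  have m: "m > 0"
    using cos_monotone_0_pi[of 0 "\<kappa> * \<alpha>"] \<kappa>\<alpha> by (simp add: m_def)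
  have m_le: "m \<le> 1 - cos (\<kappa> * x)" if "\<alpha> \<le> \<bar>x\<bar>" "\<bar>x\<bar> \<le> 2 * \<rho>" for x
  proof -
    have "\<kappa> * \<bar>x\<bar> \<le> \<kappa> * (2 * \<rho>)" "\<kappa> * \<alpha> \<le> \<kappa> * \<bar>x\<bar>"
      using that \<kappa> by (auto intro: mult_left_mono)
    then have "cos (\<kappa> * \<bar>x\<bar>) \<le> cos (\<kappa> * \<alpha>)"
      using \<kappa>\<alpha> \<rho> by (intro cos_monotone_0_pi_le) (auto simp: \<kappa>_def)
    moreover have "cos (\<kappa> * \<bar>x\<bar>) = cos (\<kappa> * x)" by (cases "x \<ge> 0") auto
    ultimately show ?thesis by (simp add: m_def)
  qed
  let ?h = "\<lambda>x. annulus_bump \<alpha> \<rho> x / max m (1 - cos (\<kappa> * x))"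
  have eq: "(1 - cos (\<kappa> * x)) * ?h x = annulus_bump \<alpha> \<rho> x" for x
  proof (cases "\<alpha> \<le> \<bar>x\<bar> \<and> \<bar>x\<bar> \<le> 2 * \<rho>")
    case True
    then show ?thesis using m_le[of x] m by (simp add: max_def)
  next
    case False
    then show ?thesis using annulus_bump_eq_0[of \<alpha> \<rho> x] \<alpha> \<rho> by auto
  qed
  have max_m: "m \<le> max m c" for c :: real by simp
  have "(\<lambda>n. Suc n * (LINT x|\<mu> n. (1 - cos (\<kappa> * x)) * ?h x))
    \<longlonglongrightarrow> t * (LINT x|\<nu>. (1 - cos (\<kappa> * x)) * ?h x)"
  proof (rule levy_small_time_limit_weighted[OF \<nu> \<mu> t char, where B = "1 / m"])
    fix x
    show "isCont ?h x"
      unfolding annulus_bump_def using \<alpha> \<rho> m by (intro continuous_intros) (auto simp: max_def)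
    show "\<bar>?h x\<bar> \<le> 1 / m"
      using m annulus_bump_bounds[of \<alpha> \<rho> x] unfolding abs_divide
      by (intro frac_le) auto
  qed
  then show ?thesis unfolding eq .
qed

text \<open>
The truncated second moment of the law at time \<open>t / (n + 1)\<close> is of order \<open>1 / (n + 1)\<close>.
\<close>

lemma eventually_small_increment_tail:
  fixes \<mu> :: "nat \<Rightarrow> real measure" and t b :: real
  assumes \<nu>: "levy_measure \<nu>" and \<mu>: "\<And>n. real_distribution (\<mu> n)" and t: "0 \<le> t"
    and char: "\<And>n u. char (\<mu> n) u = exp (complex_of_real (t / Suc n) * levy_exponent \<gamma> 0 \<nu> u)"
    and b: "0 < b" and e: "0 < e"
  shows "\<forall>\<^sub>F n in sequentially. measure (\<mu> n) {x. b \<le> \<bar>x\<bar>} < e"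
proof -
  define H where "H = enn2real (levy_growth \<gamma> \<nu> (1 / b))"
  have H: "levy_growth \<gamma> \<nu> (1 / b) = ennreal H"
    using levy_growth_finite[OF \<nu>, of \<gamma> "1 / b"] by (simp add: H_def less_top)
  have H0: "H \<ge> 0" by (simp add: H_def)
  have le: "measure (\<mu> n) {x. b \<le> \<bar>x\<bar>} \<le> 16 * (t / Suc n * H)" for n
  proof -
    interpret real_distribution "\<mu> n" by (rule \<mu>)
    have eq: "{x. b \<le> \<bar>x\<bar>} = UNIV - {-b<..<b}" by auto
    have "emeasure (\<mu> n) {x. b \<le> \<bar>x\<bar>} \<le> (\<integral>\<^sup>+x. ennreal (min 1 ((1 / b * x)\<^sup>2)) \<partial>\<mu> n)"
      unfolding eq using b by (intro emeasure_tail_le_truncated_second_moment) simp_all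
    also have "\<dots> \<le> 16 * (ennreal (t / Suc n) * levy_growth \<gamma> \<nu> (1 / b))"
      using t by (intro truncated_second_moment_le_levy_growth \<nu> \<mu> char) simp
    also have "\<dots> = ennreal (16 * (t / Suc n * H))"
      unfolding H using t H0 by (subst ennreal_mult', simp)+ simp
    finally show ?thesis unfolding measure_def using t H0 by (intro enn2real_leI) auto
  qed
  have "(\<lambda>n. 16 * (t * inverse (real (Suc n)) * H)) \<longlonglongrightarrow> 16 * (t * 0 * H)"
    by (intro tendsto_intros LIMSEQ_inverse_real_of_nat)
  then have "\<forall>\<^sub>F n in sequentially. 16 * (t / Suc n * H) < e"
    using e by (intro order_tendstoD(2)[where y = "16 * (t * 0 * H)"]) (simp_all only: divide_inverse mult_zero_left mult_zero_right)
  then show ?thesis by eventually_elim (rule le_less_trans[OF le])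
qed

section \<open>One large increment\<close>

text \<open>
The event \<open>D i\<close> says that the increment \<open>i\<close> lies in \<open>K\<close>, no other increment does, and the others sum to
at most \<open>A\<close> in absolute value. These events are disjoint, and on each of them the total is at least
\<open>2 * A - A\<close> in absolute value. The second
and third conditions do not involve increment \<open>i\<close>, so independence applies; their failure is paid for by the
three subtracted terms.
\<close>

lemma (in prob_space) single_big_jump:
  fixes \<xi> :: "nat \<Rightarrow> 'a \<Rightarrow> real" and \<mu> :: "real measure"
  assumes indep: "indep_vars (\<lambda>_. borel) \<xi> {..<n}"
    and distr: "\<And>i. i < n \<Longrightarrow> distr M borel (\<xi> i) = \<mu>"
    and K: "K \<in> sets borel" "\<And>x. x \<in> K \<Longrightarrow> 2 * A \<le> \<bar>x\<bar>"
  shows "n * measure \<mu> K * (1 - prob {\<omega> \<in> space M. A / 2 \<le> \<bar>\<Sum>i<n. \<xi> i \<omega>\<bar>}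
      - measure \<mu> {x. A / 2 \<le> \<bar>x\<bar>} - n * measure \<mu> K)
    \<le> prob {\<omega> \<in> space M. A \<le> \<bar>\<Sum>i<n. \<xi> i \<omega>\<bar>}"
proof -
  note [measurable] = K(1)
  have rv: "\<xi> i \<in> borel_measurable M" if "i < n" for i
    using indep that by (auto simp: indep_vars_def)
  have law: "measure \<mu> B = prob {\<omega> \<in> space M. \<xi> i \<omega> \<in> B}" if "i < n" "B \<in> sets borel" for i B
    unfolding distr[OF that(1), symmetric] using that rv
    by (subst measure_distr) (auto intro!: arg_cong[where f = prob])
  define p where "p = measure \<mu> K"
  define q1 where "q1 = prob {\<omega> \<in> space M. A / 2 \<le> \<bar>\<Sum>i<n. \<xi> i \<omega>\<bar>}"
  define q2 where "q2 = measure \<mu> {x. A / 2 \<le> \<bar>x\<bar>}"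
  define R where "R i = {..<n} - {i}" for i
  define E where "E i = {\<omega> \<in> space M. \<bar>\<Sum>j\<in>R i. \<xi> j \<omega>\<bar> \<le> A \<and> (\<forall>j\<in>R i. \<xi> j \<omega> \<notin> K)}" for i
  define D where "D i = {\<omega> \<in> space M. \<xi> i \<omega> \<in> K} \<inter> E i" for i
  have R: "finite (R i)" "j \<in> R i \<Longrightarrow> j < n" for i j by (auto simp: R_def)
  have rvR: "\<xi> j \<in> borel_measurable M" if "j \<in> R i" for i j using R that rv by auto
  have E_meas: "E i \<in> events" for i
    unfolding E_def using R rvR
    by (intro sets.sets_Collect_conj sets.sets_Collect_finite_All)
      (measurable, auto)
  have D_meas: "D i \<in> events" if "i < n" for i
    unfolding D_def using rv[OF that] E_meas by measurable
  have sum_split: "(\<Sum>j<n. \<xi> j \<omega>) = \<xi> i \<omega> + (\<Sum>j\<in>R i. \<xi> j \<omega>)" if "i < n" for i \<omega>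
    unfolding R_def using that by (intro sum.remove) auto
  have D_prob: "prob (D i) = p * prob (E i)" if i: "i < n" for i
  proof -
    have ind: "indep_var (PiM {i} (\<lambda>_. borel)) (\<lambda>\<omega>. restrict (\<lambda>j. \<xi> j \<omega>) {i})
        (PiM (R i) (\<lambda>_. borel)) (\<lambda>\<omega>. restrict (\<lambda>j. \<xi> j \<omega>) (R i))"
      using i by (intro indep_var_restrict[OF indep]) (auto simp: R_def)
    define Xa where "Xa = {f \<in> space (PiM {i} (\<lambda>_. borel :: real measure)). f i \<in> K}"
    define Xb where "Xb = {f \<in> space (PiM (R i) (\<lambda>_. borel :: real measure)).
        \<bar>\<Sum>j\<in>R i. f j\<bar> \<le> A \<and> (\<forall>j\<in>R i. f j \<notin> K)}"
    have "Xa \<in> sets (PiM {i} (\<lambda>_. borel))" unfolding Xa_def by measurable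
    moreover have "Xb \<in> sets (PiM (R i) (\<lambda>_. borel))"
    proof -
      have comp [measurable]: "(\<lambda>f. f j) \<in> borel_measurable (PiM (R i) (\<lambda>_. borel :: real measure))" if "j \<in> R i" for j
        using that by (rule measurable_component_singleton)
      have [measurable]: "(\<lambda>f. \<Sum>j\<in>R i. f j) \<in> borel_measurable (PiM (R i) (\<lambda>_. borel :: real measure))"
        by (intro borel_measurable_sum comp)
      have "{f \<in> space (PiM (R i) (\<lambda>_. borel :: real measure)). f j \<notin> K} \<in> sets (PiM (R i) (\<lambda>_. borel))"
        if "j \<in> R i" for j using comp[OF that] by measurable
      then show ?thesis
        unfolding Xb_def using R(1)[of i] by (intro sets.sets_Collect_conj sets.sets_Collect_finite_All) measurable
    qed
    ultimately have "prob ((\<lambda>\<omega>. (restrict (\<lambda>j. \<xi> j \<omega>) {i}, restrict (\<lambda>j. \<xi> j \<omega>) (R i))) -` (Xa \<times> Xb) \<inter> space M)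
        = prob ((\<lambda>\<omega>. restrict (\<lambda>j. \<xi> j \<omega>) {i}) -` Xa \<inter> space M)
          * prob ((\<lambda>\<omega>. restrict (\<lambda>j. \<xi> j \<omega>) (R i)) -` Xb \<inter> space M)"
      by (rule indep_varD[OF ind])
    moreover have "(\<lambda>\<omega>. restrict (\<lambda>j. \<xi> j \<omega>) {i}) -` Xa \<inter> space M = {\<omega> \<in> space M. \<xi> i \<omega> \<in> K}"
      by (auto simp: Xa_def space_PiM)
    moreover have "(\<lambda>\<omega>. restrict (\<lambda>j. \<xi> j \<omega>) (R i)) -` Xb \<inter> space M = E i"
      by (auto simp: Xb_def E_def space_PiM)
    moreover have "(\<lambda>\<omega>. (restrict (\<lambda>j. \<xi> j \<omega>) {i}, restrict (\<lambda>j. \<xi> j \<omega>) (R i))) -` (Xa \<times> Xb) \<inter> space M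
        = (\<lambda>\<omega>. restrict (\<lambda>j. \<xi> j \<omega>) {i}) -` Xa \<inter> space M \<inter> ((\<lambda>\<omega>. restrict (\<lambda>j. \<xi> j \<omega>) (R i)) -` Xb \<inter> space M)"
      by auto
    ultimately show ?thesis using law[OF i K(1)] by (simp add: D_def p_def)
  qed
  have E_prob: "1 - q1 - q2 - n * p \<le> prob (E i)" if i: "i < n" for i
  proof -
    let ?F = "{\<omega> \<in> space M. A / 2 \<le> \<bar>\<Sum>j<n. \<xi> j \<omega>\<bar>}"
    let ?G = "{\<omega> \<in> space M. \<xi> i \<omega> \<in> {x. A / 2 \<le> \<bar>x\<bar>}}"
    let ?H = "\<lambda>j. {\<omega> \<in> space M. \<xi> j \<omega> \<in> K}"
    have [measurable]: "(\<lambda>\<omega>. \<Sum>j<n. \<xi> j \<omega>) \<in> borel_measurable M" using rv by (intro borel_measurable_sum) auto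
    have F: "?F \<in> events" by measurable
    have G: "?G \<in> events" using rv[OF i] by measurable
    have H: "?H j \<in> events" if "j < n" for j using rv[OF that] by measurable
    have UH: "(\<Union>j<n. ?H j) \<in> events" using H by auto
    have "space M - E i \<subseteq> ?F \<union> ?G \<union> (\<Union>j<n. ?H j)"
    proof
      fix \<omega> assume \<omega>: "\<omega> \<in> space M - E i"
      show "\<omega> \<in> ?F \<union> ?G \<union> (\<Union>j<n. ?H j)"
      proof (cases "\<exists>j\<in>R i. \<xi> j \<omega> \<in> K")
        case True
        then show ?thesis using \<omega> R by auto
      next
        case False
        then have "A < \<bar>\<Sum>j\<in>R i. \<xi> j \<omega>\<bar>" using \<omega> by (auto simp: E_def)
        then have "A / 2 \<le> \<bar>\<Sum>j<n. \<xi> j \<omega>\<bar> \<or> A / 2 \<le> \<bar>\<xi> i \<omega>\<bar>"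
          using sum_split[OF i, of \<omega>] by linarith
        then show ?thesis using \<omega> by auto
      qed
    qed
    then have "prob (space M - E i) \<le> prob (?F \<union> ?G \<union> (\<Union>j<n. ?H j))"
      using F G UH by (intro finite_measure_mono sets.Un) auto
    also have "\<dots> \<le> prob ?F + prob ?G + prob (\<Union>j<n. ?H j)"
      using F G UH by (intro order_trans[OF measure_Un_le] add_mono measure_Un_le sets.Un order_refl)
    also have "prob (\<Union>j<n. ?H j) \<le> (\<Sum>j<n. prob (?H j))"
      using H by (intro finite_measure_subadditive_finite) auto
    also have "(\<Sum>j<n. prob (?H j)) = n * p" by (simp add: p_def law[OF _ K(1), symmetric])
    also have "prob ?G = q2" using law[OF i, of "{x. A / 2 \<le> \<bar>x\<bar>}"] by (simp add: q2_def)
    also have "prob (space M - E i) = 1 - prob (E i)" by (rule prob_compl[OF E_meas])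
    finally show ?thesis by (simp add: q1_def)
  qed
  have "n * p * (1 - q1 - q2 - n * p) = (\<Sum>i<n. p * (1 - q1 - q2 - n * p))" by simp
  also have "\<dots> \<le> (\<Sum>i<n. prob (D i))"
    using E_prob D_prob by (intro sum_mono) (auto simp: p_def intro!: mult_left_mono)
  also have "\<dots> = prob (\<Union>i<n. D i)"
  proof (rule finite_measure_finite_Union[symmetric])
    show "disjoint_family_on D {..<n}"
      by (auto simp: disjoint_family_on_def D_def E_def R_def)
  qed (use D_meas in auto)
  also have "\<dots> \<le> prob {\<omega> \<in> space M. A \<le> \<bar>\<Sum>i<n. \<xi> i \<omega>\<bar>}"
  proof (rule finite_measure_mono)
    show "(\<Union>i<n. D i) \<subseteq> {\<omega> \<in> space M. A \<le> \<bar>\<Sum>i<n. \<xi> i \<omega>\<bar>}"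
    proof
      fix \<omega> assume "\<omega> \<in> (\<Union>i<n. D i)"
      then obtain i where i: "i < n" "\<omega> \<in> D i" by auto
      then have "2 * A \<le> \<bar>\<xi> i \<omega>\<bar>" "\<bar>\<Sum>j\<in>R i. \<xi> j \<omega>\<bar> \<le> A" using K(2) by (auto simp: D_def E_def)
      then have "A \<le> \<bar>\<Sum>i<n. \<xi> i \<omega>\<bar>" using sum_split[OF i(1), of \<omega>] by linarith
      then show "\<omega> \<in> {\<omega> \<in> space M. A \<le> \<bar>\<Sum>i<n. \<xi> i \<omega>\<bar>}" using i by (auto simp: D_def)
    qed
    have "(\<lambda>\<omega>. \<Sum>i<n. \<xi> i \<omega>) \<in> borel_measurable M" using rv by (intro borel_measurable_sum) auto
    then show "{\<omega> \<in> space M. A \<le> \<bar>\<Sum>i<n. \<xi> i \<omega>\<bar>} \<in> events" by measurable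
  qed
  finally show ?thesis by (simp add: p_def q1_def q2_def)
qed

text \<open>
The last claim identifies the law of the telescoping sum \<open>X t - X 0\<close> with that of \<open>X t\<close>, because
\<open>X 0\<close> vanishes almost surely.
\<close>

lemma (in levy_process) increments_on_grid:
  assumes t: "0 < t" and s: "s = t / real n" and n: "0 < n"
  shows "indep_vars (\<lambda>_. borel) (\<lambda>i \<omega>. X (real (Suc i) * s) \<omega> - X (real i * s) \<omega>) {..<n}"
    and "distr M borel (\<lambda>\<omega>. X (real (Suc i) * s) \<omega> - X (real i * s) \<omega>) = distr M borel (X s)"
    and "B \<in> sets borel \<Longrightarrow>
      prob {\<omega> \<in> space M. (\<Sum>i<n. X (real (Suc i) * s) \<omega> - X (real i * s) \<omega>) \<in> B}
        = measure (distr M borel (X t)) B"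
proof -
  have s0: "s > 0" using t s n by simp
  show "indep_vars (\<lambda>_. borel) (\<lambda>i \<omega>. X (real (Suc i) * s) \<omega> - X (real i * s) \<omega>) {..<n}"
    using s0 by (intro independent_increments) (auto simp: strict_mono_on_def)
  have "real (Suc i) * s = real i * s + s" by (simp add: algebra_simps)
  then show "distr M borel (\<lambda>\<omega>. X (real (Suc i) * s) \<omega> - X (real i * s) \<omega>) = distr M borel (X s)"
    using stationary_increments[of "real i * s" s] s0 by simp
  assume B: "B \<in> sets borel"
  have [measurable]: "random_variable borel (X t)" "random_variable borel (X 0)"
    using random_variable t by auto
  have ns: "real n * s = t" using s n by simp
  have sum: "(\<Sum>i<n. X (real (Suc i) * s) \<omega> - X (real i * s) \<omega>) = X t \<omega> - X 0 \<omega>" for \<omega>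
    using sum_lessThan_telescope[of "\<lambda>i. X (real i * s) \<omega>" n] ns by simp
  have "prob {\<omega> \<in> space M. X t \<omega> - X 0 \<omega> \<in> B} = prob {\<omega> \<in> space M. X t \<omega> \<in> B}"
  proof (rule measure_eq_AE)
    show "AE \<omega> in M. (\<omega> \<in> {\<omega> \<in> space M. X t \<omega> - X 0 \<omega> \<in> B}) = (\<omega> \<in> {\<omega> \<in> space M. X t \<omega> \<in> B})"
      using start_zero by eventually_elim simp
  qed (use B in measurable)
  also have "\<dots> = measure (distr M borel (X t)) B"
    using B by (subst measure_distr) (auto intro!: arg_cong[where f = prob])
  finally show "prob {\<omega> \<in> space M. (\<Sum>i<n. X (real (Suc i) * s) \<omega> - X (real i * s) \<omega>) \<in> B}
        = measure (distr M borel (X t)) B"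
    unfolding sum .
qed

section \<open>The tail of the Levy measure is controlled by the tail of the marginal law\<close>

lemma real_distribution_law:
  assumes "levy_process M X" "0 \<le> t"
  shows "real_distribution (distr M borel (X t))"
proof -
  interpret levy_process M X by fact
  show ?thesis using random_variable[OF assms(2)] by (rule real_distribution_distr)
qed

text \<open>
If \<open>X t\<close> is mostly smaller than \<open>a\<close>, its characteristic function has modulus at least \<open>1 - 1 / 64\<close> at all
frequencies up to \<open>1 / (128 * a)\<close>. As the modulus is \<open>exp (t * Re \<psi>)\<close>, this forces \<open>- t * Re \<psi> \<le> 1 / 32\<close> there,
and the factor 8 of \<open>truncated_second_moment_le\<close> gives \<open>8 / 32 = 1 / 4\<close>.
\<close>

lemma levy_measure_tail_small_if_tail_small:
  fixes a t :: real
  assumes \<nu>: "levy_measure \<nu>" and \<mu>: "real_distribution \<mu>"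
    and char: "\<And>u. char \<mu> u = exp (complex_of_real t * levy_exponent \<gamma> 0 \<nu> u)"
    and t: "0 < t" and a: "0 < a" and small: "measure \<mu> {x. a \<le> \<bar>x\<bar>} \<le> 1 / 256"
  shows "t * measure \<nu> (UNIV - {-(128 * a)<..<128 * a}) \<le> 1 / 4"
proof -
  have sets: "sets \<nu> = sets borel" using \<nu> by (simp add: levy_measure_def)
  let ?\<psi> = "levy_exponent \<gamma> 0 \<nu>"
  \<comment> \<open>\<open>1 - 1 / 128 - 2 / 256 = 63 / 64\<close> exceeds \<open>32 / 33 \<ge> exp (- 1 / 32)\<close>.\<close>
  have Re: "- Re (?\<psi> v) \<le> 1 / (32 * t)" if v: "\<bar>v\<bar> \<le> 1 / (128 * a)" for v
  proof (rule ccontr)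
    assume "\<not> - Re (?\<psi> v) \<le> 1 / (32 * t)"
    then have "t * Re (?\<psi> v) < - (1 / 32)" using t by (simp add: field_simps)
    then have "exp (t * Re (?\<psi> v)) \<le> exp (- (1 / 32))" by simp
    also have "exp (- (1 / 32)) \<le> (32 / 33 :: real)"
      using exp_ge_add_one_self[of "1 / 32 :: real"] by (simp add: exp_minus field_simps)
    finally have "norm (char \<mu> v) \<le> 32 / 33" by (simp add: char)
    moreover have "\<bar>v\<bar> * a \<le> 1 / 128" using v a by (simp add: field_simps)
    moreover have "1 - norm (char \<mu> v) \<le> \<bar>v\<bar> * a + 2 * measure \<mu> {x. a \<le> \<bar>x\<bar>}"
      using one_minus_norm_char_le[OF \<mu>] a by simp
    ultimately show False using small by simp
  qed
  have "emeasure \<nu> (UNIV - {-(128 * a)<..<128 * a}) \<le> (\<integral>\<^sup>+x. ennreal (min 1 ((1 / (128 * a) * x)\<^sup>2)) \<partial>\<nu>)"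
    using a by (intro emeasure_tail_le_truncated_second_moment sets) simp
  also have "\<dots> \<le> 8 * ennreal (1 / (32 * t))"
  proof (rule truncated_second_moment_le[OF levy_measure_sigma_finite[OF \<nu>] sets])
    fix s :: real assume s: "s \<in> {0..1}"
    have "- Re (?\<psi> (s * (1 / (128 * a)))) \<le> 1 / (32 * t)"
      using s a by (intro Re) (simp add: abs_mult divide_right_mono)
    then show "(\<integral>\<^sup>+x. ennreal (1 - cos (s * (1 / (128 * a)) * x)) \<partial>\<nu>) \<le> ennreal (1 / (32 * t))"
      unfolding nn_integral_one_minus_cos[OF \<nu>, of _ \<gamma>] by (rule ennreal_leI)
  qed
  also have "\<dots> = ennreal (8 * (1 / (32 * t)))" using t by (subst ennreal_mult') auto
  finally have "measure \<nu> (UNIV - {-(128 * a)<..<128 * a}) \<le> 8 * (1 / (32 * t))"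
    unfolding measure_def using t by (intro enn2real_leI) auto
  then show ?thesis using t by (simp add: field_simps)
qed

text \<open>
The inequality of \<open>single_big_jump\<close> is applied to the \<open>n\<close> increments of length \<open>t / n\<close> with the window
\<open>2 * A \<le> \<bar>x\<bar> \<le> 2 * r\<close>, where \<open>A = 128 * a\<close>. It has the form \<open>z * (1 - p0 - q - z) \<le> p0\<close>, with \<open>z\<close> the
expected number of increments in the window, \<open>p0\<close> the tail of \<open>X t\<close> and \<open>q\<close> the tail of one increment. Once
the bracket is at least \<open>1 / 2\<close> this yields \<open>z \<le> 2 * p0\<close>. Two bumps sandwich the indicator of the window:
the outer one shows that \<open>z\<close> is eventually below \<open>1 / 3\<close>, the inner one carries the bound \<open>2 * p0\<close> over to \<open>\<nu>\<close>.
\<close>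

lemma levy_measure_le_tail_on_annulus:
  assumes X: "levy_process M X" and triplet: "has_levy_triplet M X \<gamma> 0 \<nu>"
    and t: "0 < t" and a: "0 < a"
    and small: "measure (distr M borel (X t)) {x. a \<le> \<bar>x\<bar>} \<le> 1 / 256"
    and r: "512 * a \<le> r"
  shows "ennreal t * emeasure \<nu> {x. 512 * a \<le> \<bar>x\<bar> \<and> \<bar>x\<bar> \<le> r}
    \<le> ennreal (2 * measure (distr M borel (X t)) {x. a \<le> \<bar>x\<bar>})"
proof -
  interpret levy_process M X by fact
  have \<nu>: "levy_measure \<nu>"
    and char_t: "\<And>t u. 0 \<le> t \<Longrightarrow> char (distr M borel (X t)) u = exp (complex_of_real t * levy_exponent \<gamma> 0 \<nu> u)"
    using triplet by (auto simp: has_levy_triplet_def)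
  have [measurable_cong]: "sets \<nu> = sets borel" using \<nu> by (simp add: levy_measure_def)
  define \<mu> where "\<mu> n = distr M borel (X (t / Suc n))" for n
  have \<mu>: "real_distribution (\<mu> n)" for n
    unfolding \<mu>_def using t by (intro real_distribution_law[OF X]) simp
  interpret \<mu>: real_distribution "\<mu> n" for n by (rule \<mu>)
  have char_\<mu>: "char (\<mu> n) u = exp (complex_of_real (t / Suc n) * levy_exponent \<gamma> 0 \<nu> u)" for n u
    unfolding \<mu>_def using t by (intro char_t) simp
  interpret law: real_distribution "distr M borel (X t)"
    using t by (intro real_distribution_law[OF X]) simp
  define p0 where "p0 = measure (distr M borel (X t)) {x. a \<le> \<bar>x\<bar>}"
  define A where "A = 128 * a"
  have A: "A > 0" "a \<le> A / 2" "a \<le> A" using a by (simp_all add: A_def)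
  define R where "R = 2 * r"
  define K where "K = {x::real. 2 * A \<le> \<bar>x\<bar> \<and> \<bar>x\<bar> \<le> R}"
  have K [measurable]: "K \<in> sets borel" unfolding K_def by measurable
  define z where "z n = Suc n * measure (\<mu> n) K" for n
  have R': "2 * A \<le> r" "0 < r" "A \<le> R" "0 < R" using r a by (simp_all add: A_def R_def)

  have int_\<mu>: "integrable (\<mu> n) (annulus_bump \<alpha> \<rho>)" for n \<alpha> \<rho>
    by (intro \<mu>.integrable_const_bound[where B = 1]) (auto simp: annulus_bump_bounds)
  have K_\<mu>: "(LINT x|\<mu> n. indicator K x) = measure (\<mu> n) K" "integrable (\<mu> n) (indicator K :: real \<Rightarrow> real)" for n
    by (simp_all add: less_top[symmetric])
  have tail_fin: "emeasure \<nu> (UNIV - {-A<..<A}) < \<infinity>"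
    using nu_bar_finite[OF \<nu> A(1)] by (simp add: nu_bar_def)
  have int_tail: "integrable \<nu> (indicator (UNIV - {-A<..<A}) :: real \<Rightarrow> real)"
    using tail_fin by (intro integrable_real_indicator) auto
  have int_\<nu>: "integrable \<nu> (annulus_bump \<alpha> \<rho>)" if "A \<le> \<alpha>" "0 < \<rho>" for \<alpha> \<rho>
  proof (rule Bochner_Integration.integrable_bound[OF int_tail])
    have "annulus_bump \<alpha> \<rho> x \<le> indicator (UNIV - {-A<..<A}) x" for x
      using that A(1) by (intro annulus_bump_le_indicator) auto
    then show "AE x in \<nu>. norm (annulus_bump \<alpha> \<rho> x) \<le> norm (indicator (UNIV - {-A<..<A}) x :: real)"
      by (intro always_eventually allI) (simp add: annulus_bump_bounds)
  qed measurable

  \<comment> \<open>The limit of the expected number of increments in the window is at most \<open>1 / 4\<close>.\<close>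
  have "(LINT x|\<nu>. annulus_bump A R x) \<le> (LINT x|\<nu>. indicator (UNIV - {-A<..<A}) x)"
    using R' A by (intro integral_mono int_\<nu> int_tail annulus_bump_le_indicator) auto
  also have "\<dots> = measure \<nu> (UNIV - {-A<..<A})" by simp
  finally have "t * (LINT x|\<nu>. annulus_bump A R x) \<le> t * measure \<nu> (UNIV - {-A<..<A})"
    using t by (intro mult_left_mono) auto
  also have "\<dots> \<le> 1 / 4"
    unfolding A_def using t by (intro levy_measure_tail_small_if_tail_small[OF \<nu> law.real_distribution_axioms char_t t a small]) simp
  finally have "t * (LINT x|\<nu>. annulus_bump A R x) < 1 / 3" by simp
  then have bump_small: "\<forall>\<^sub>F n in sequentially. Suc n * (LINT x|\<mu> n. annulus_bump A R x) < 1 / 3"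
    using t A R' by (intro order_tendstoD(2)[OF levy_small_time_limit[OF \<nu> \<mu> _ char_\<mu>]]) auto
  have z_bump: "z n \<le> Suc n * (LINT x|\<mu> n. annulus_bump A R x)" for n
    unfolding z_def K_\<mu>(1)[symmetric] using A R'
    by (intro mult_left_mono integral_mono int_\<mu> K_\<mu>(2) indicator_le_annulus_bump) (auto simp: K_def)
  have z_small: "\<forall>\<^sub>F n in sequentially. z n < 1 / 3"
    using bump_small by (rule eventually_mono) (rule le_less_trans[OF z_bump])

  have q_small: "\<forall>\<^sub>F n in sequentially. measure (\<mu> n) {x. A / 2 \<le> \<bar>x\<bar>} < 1 / 8"
    using t A by (intro eventually_small_increment_tail[OF \<nu> \<mu> _ char_\<mu>]) auto

  have jump: "z n * (1 - p0 - measure (\<mu> n) {x. A / 2 \<le> \<bar>x\<bar>} - z n) \<le> p0" for n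
  proof -
    define s where "s = t / real (Suc n)"
    define S where "S \<omega> = (\<Sum>i<Suc n. X (real (Suc i) * s) \<omega> - X (real i * s) \<omega>)" for \<omega>
    note inc = increments_on_grid[OF t s_def zero_less_Suc]
    have S: "prob {\<omega> \<in> space M. b \<le> \<bar>S \<omega>\<bar>} \<le> p0" if "a \<le> b" for b
    proof -
      have "prob {\<omega> \<in> space M. b \<le> \<bar>S \<omega>\<bar>} = measure (distr M borel (X t)) {x. b \<le> \<bar>x\<bar>}"
        using inc(3)[of "{x. b \<le> \<bar>x\<bar>}"] by (simp add: S_def)
      also have "\<dots> \<le> p0"
        unfolding p0_def using that by (intro law.finite_measure_mono) auto
      finally show ?thesis .
    qed
    have "z n * (1 - p0 - measure (\<mu> n) {x. A / 2 \<le> \<bar>x\<bar>} - z n)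
      \<le> z n * (1 - prob {\<omega> \<in> space M. A / 2 \<le> \<bar>S \<omega>\<bar>} - measure (\<mu> n) {x. A / 2 \<le> \<bar>x\<bar>} - z n)"
      using S[OF A(2)] by (intro mult_left_mono) (auto simp: z_def)
    also have "\<dots> \<le> prob {\<omega> \<in> space M. A \<le> \<bar>S \<omega>\<bar>}"
      unfolding S_def z_def
    proof (rule single_big_jump[OF inc(1)])
      show "distr M borel (\<lambda>\<omega>. X (real (Suc i) * s) \<omega> - X (real i * s) \<omega>) = \<mu> n" for i
        unfolding inc(2) by (simp add: \<mu>_def s_def)
    qed (auto simp: K_def)
    also have "\<dots> \<le> p0" by (rule S[OF A(3)])
    finally show ?thesis .
  qed
  \<comment> \<open>Indeed \<open>1 / 256 + 1 / 8 + 1 / 3 < 1 / 2\<close>.\<close>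
  have z_le: "\<forall>\<^sub>F n in sequentially. z n \<le> 2 * p0"
    using z_small q_small
  proof eventually_elim
    case (elim n)
    have "1 / 2 \<le> 1 - p0 - measure (\<mu> n) {x. A / 2 \<le> \<bar>x\<bar>} - z n"
      using elim small by (simp add: p0_def)
    then have "z n * (1 / 2) \<le> z n * (1 - p0 - measure (\<mu> n) {x. A / 2 \<le> \<bar>x\<bar>} - z n)"
      by (intro mult_left_mono) (auto simp: z_def)
    then show ?case using jump[of n] by linarith
  qed

  have "Suc n * (LINT x|\<mu> n. annulus_bump (2 * A) (r) x) \<le> z n" for n
    unfolding z_def K_\<mu>(1)[symmetric]
    using A R' by (intro mult_left_mono integral_mono int_\<mu> K_\<mu>(2) annulus_bump_le_indicator) (auto simp: K_def R_def)
  then have "\<forall>\<^sub>F n in sequentially. Suc n * (LINT x|\<mu> n. annulus_bump (2 * A) (r) x) \<le> 2 * p0"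
    using z_le by (auto elim!: eventually_mono intro: order_trans)
  then have le: "t * (LINT x|\<nu>. annulus_bump (2 * A) (r) x) \<le> 2 * p0"
    using t A R' by (intro tendsto_upperbound[OF levy_small_time_limit[OF \<nu> \<mu> _ char_\<mu>]]) auto
  have "emeasure \<nu> {x. 512 * a \<le> \<bar>x\<bar> \<and> \<bar>x\<bar> \<le> r}
    = (\<integral>\<^sup>+x. indicator {x. 512 * a \<le> \<bar>x\<bar> \<and> \<bar>x\<bar> \<le> r} x \<partial>\<nu>)" by simp
  also have "\<dots> \<le> (\<integral>\<^sup>+x. ennreal (annulus_bump (2 * A) (r) x) \<partial>\<nu>)"
    using annulus_bump_eq_1[of "2 * A" "r"] A R'
    by (intro nn_integral_mono) (auto simp: indicator_def A_def)
  also have "\<dots> = ennreal (LINT x|\<nu>. annulus_bump (2 * A) (r) x)"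
    using A R' by (intro nn_integral_eq_integral int_\<nu>) (auto simp: annulus_bump_bounds)
  finally have "ennreal t * emeasure \<nu> {x. 512 * a \<le> \<bar>x\<bar> \<and> \<bar>x\<bar> \<le> r}
    \<le> ennreal t * ennreal (LINT x|\<nu>. annulus_bump (2 * A) (r) x)"
    by (rule mult_left_mono) simp
  also have "\<dots> = ennreal (t * (LINT x|\<nu>. annulus_bump (2 * A) (r) x))"
    using t by (simp add: ennreal_mult')
  also have "\<dots> \<le> ennreal (2 * p0)" by (rule ennreal_leI[OF le])
  finally show ?thesis by (simp add: p0_def)
qed

text \<open>
The outer radius of the annulus tends to infinity.
\<close>

lemma levy_measure_tail_le:
  assumes X: "levy_process M X" and triplet: "has_levy_triplet M X \<gamma> 0 \<nu>"
    and t: "0 < t" and a: "0 < a"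
    and small: "measure (distr M borel (X t)) {x. a \<le> \<bar>x\<bar>} \<le> 1 / 256"
  shows "ennreal t * nu_bar \<nu> (512 * a)
    \<le> ennreal (2 * measure (distr M borel (X t)) {x. a \<le> \<bar>x\<bar>})"
proof -
  have [measurable_cong]: "sets \<nu> = sets borel"
    using triplet by (simp add: has_levy_triplet_def levy_measure_def)
  define B where "B k = {x. 512 * a \<le> \<bar>x\<bar> \<and> \<bar>x\<bar> \<le> 512 * a + real k}" for k
  have "UNIV - {-(512 * a)<..<512 * a} = (\<Union>k. B k)"
  proof -
    have "\<exists>k. \<bar>x\<bar> \<le> 512 * a + real k" for x :: real
      using real_arch_simple[of "\<bar>x\<bar> - 512 * a"] by (auto simp: algebra_simps)
    moreover have "x \<in> UNIV - {-(512 * a)<..<512 * a} \<longleftrightarrow> 512 * a \<le> \<bar>x\<bar>" for x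
      using a by auto
    ultimately show ?thesis by (auto simp: B_def)
  qed
  then have "nu_bar \<nu> (512 * a) = (SUP k. emeasure \<nu> (B k))"
    unfolding nu_bar_def by (subst SUP_emeasure_incseq) (auto simp: B_def incseq_def)
  also have "ennreal t * \<dots> = (SUP k. ennreal t * emeasure \<nu> (B k))"
    by (rule SUP_mult_left_ennreal)
  also have "\<dots> \<le> ennreal (2 * measure (distr M borel (X t)) {x. a \<le> \<bar>x\<bar>})"
  proof (rule SUP_least)
    fix k
    show "ennreal t * emeasure \<nu> (B k) \<le> ennreal (2 * measure (distr M borel (X t)) {x. a \<le> \<bar>x\<bar>})"
      using levy_measure_le_tail_on_annulus[OF X triplet t a small, of "512 * a + real k"]
      by (simp add: B_def)
  qed
  finally show ?thesis .
qed

section \<open>Finiteness of the process integral\<close>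

text \<open>
The contribution of a jump of size \<open>x\<close> to the time integral of the growth bound at frequency
\<open>t powr (-1 / \<beta>)\<close>.
\<close>

definition scaled_kernel :: "real \<Rightarrow> real \<Rightarrow> ennreal" where
  "scaled_kernel \<beta> x =
    (\<integral>\<^sup>+t\<in>{0<..1}. ennreal (min ((t powr (-1 / \<beta>) * x)\<^sup>2) \<bar>t powr (-1 / \<beta>) * x\<bar>) \<partial>lborel)"

lemma nn_integral_powr_0:
  fixes a c :: real
  assumes "-1 < a" "0 \<le> c"
  shows "(\<integral>\<^sup>+t\<in>{0..c}. ennreal (t powr a) \<partial>lborel) = ennreal (c powr (a + 1) / (a + 1))"
  by (intro nn_integral_has_integral_lebesgue' has_integral_powr_from_0 assms) simp

text \<open>
The two arguments of the minimum are equal at \<open>t = \<bar>x\<bar> powr \<beta>\<close>. Before that time the linear one is smaller, and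
\<open>t powr (-1 / \<beta>)\<close> is integrable at \<open>0\<close> because \<open>\<beta> > 1\<close>; after it the quadratic one is used, whose
integral \<open>T\<close> depends on whether \<open>\<beta>\<close> is below or equal to \<open>2\<close>.
\<close>

lemma scaled_kernel_le:
  assumes \<beta>: "1 < \<beta>" and x: "x \<noteq> 0" "\<bar>x\<bar> < 1"
    and tail: "((\<lambda>t. t powr (-2 / \<beta>)) has_integral T) {\<bar>x\<bar> powr \<beta>..1}"
  shows "scaled_kernel \<beta> x \<le> ennreal (\<beta> / (\<beta> - 1) * \<bar>x\<bar> powr \<beta> + x\<^sup>2 * T)"
proof -
  define c where "c = \<bar>x\<bar> powr \<beta>"
  have T: "0 \<le> T" using tail by (rule has_integral_nonneg) simp
  have "scaled_kernel \<beta> x \<le> (\<integral>\<^sup>+t. ennreal \<bar>x\<bar> * (ennreal (t powr (-1 / \<beta>)) * indicator {0..c} t)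
      + ennreal (x\<^sup>2) * (ennreal (t powr (-2 / \<beta>)) * indicator {c..1} t) \<partial>lborel)"
    unfolding scaled_kernel_def
  proof (intro nn_integral_mono)
    fix t :: real
    show "ennreal (min ((t powr (-1 / \<beta>) * x)\<^sup>2) \<bar>t powr (-1 / \<beta>) * x\<bar>) * indicator {0<..1} t
      \<le> ennreal \<bar>x\<bar> * (ennreal (t powr (-1 / \<beta>)) * indicator {0..c} t)
      + ennreal (x\<^sup>2) * (ennreal (t powr (-2 / \<beta>)) * indicator {c..1} t)"
    proof (cases "t \<in> {0<..1}")
      case True
      show ?thesis
      proof (cases "t \<le> c")
        case le: True
        have "ennreal (min ((t powr (-1 / \<beta>) * x)\<^sup>2) \<bar>t powr (-1 / \<beta>) * x\<bar>) \<le> ennreal (\<bar>x\<bar> * t powr (-1 / \<beta>))"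
          by (intro ennreal_leI) (simp add: abs_mult mult.commute)
        then show ?thesis using True le by (simp add: ennreal_mult' add_increasing2)
      next
        case False
        have "t powr (-2 / \<beta>) = (t powr (-1 / \<beta>))\<^sup>2"
          using True by (simp add: power2_eq_square flip: powr_add)
        then have "ennreal (min ((t powr (-1 / \<beta>) * x)\<^sup>2) \<bar>t powr (-1 / \<beta>) * x\<bar>) \<le> ennreal (x\<^sup>2 * t powr (-2 / \<beta>))"
          by (intro ennreal_leI) (simp add: power_mult_distrib mult.commute)
        then show ?thesis using True False by (simp add: ennreal_mult')
      qed
    qed simp
  qed
  also have "\<dots> = ennreal \<bar>x\<bar> * (\<integral>\<^sup>+t\<in>{0..c}. ennreal (t powr (-1 / \<beta>)) \<partial>lborel)
      + ennreal (x\<^sup>2) * (\<integral>\<^sup>+t\<in>{c..1}. ennreal (t powr (-2 / \<beta>)) \<partial>lborel)"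
    by (subst nn_integral_add) (simp_all add: nn_integral_cmult)
  also have "(\<integral>\<^sup>+t\<in>{c..1}. ennreal (t powr (-2 / \<beta>)) \<partial>lborel) = ennreal T"
    using tail unfolding c_def by (intro nn_integral_has_integral_lebesgue') simp_all
  also have "(\<integral>\<^sup>+t\<in>{0..c}. ennreal (t powr (-1 / \<beta>)) \<partial>lborel) = ennreal (c powr (-1 / \<beta> + 1) / (-1 / \<beta> + 1))"
    using \<beta> by (intro nn_integral_powr_0) (simp_all add: c_def)
  also have "c powr (-1 / \<beta> + 1) / (-1 / \<beta> + 1) = \<bar>x\<bar> powr (\<beta> - 1) * (\<beta> / (\<beta> - 1))"
  proof -
    have "\<beta> * (-1 / \<beta> + 1) = \<beta> - 1" using \<beta> by (simp add: field_simps)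
    moreover have "-1 / \<beta> + 1 = (\<beta> - 1) / \<beta>" using \<beta> by (simp add: field_simps)
    ultimately show ?thesis by (simp add: c_def powr_powr)
  qed
  also have "ennreal \<bar>x\<bar> * ennreal (\<bar>x\<bar> powr (\<beta> - 1) * (\<beta> / (\<beta> - 1))) = ennreal (\<beta> / (\<beta> - 1) * \<bar>x\<bar> powr \<beta>)"
    using x \<beta> by (simp add: powr_diff flip: ennreal_mult')
  also have "ennreal (x\<^sup>2) * ennreal T = ennreal (x\<^sup>2 * T)" using T by (simp add: ennreal_mult')
  finally show ?thesis using T \<beta> by simp
qed

lemma scaled_kernel_le_powr:
  assumes \<beta>: "1 < \<beta>" "\<beta> < 2" and x: "\<bar>x\<bar> < 1"
  shows "scaled_kernel \<beta> x \<le> ennreal (\<beta> / (\<beta> - 1) + \<beta> / (2 - \<beta>)) * ennreal (\<bar>x\<bar> powr \<beta>)"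
proof (cases "x = 0")
  case True
  then show ?thesis by (simp add: scaled_kernel_def)
next
  case False
  define c where "c = \<bar>x\<bar> powr \<beta>"
  define e where "e = 2 / \<beta> - 1"
  have e: "e > 0" using \<beta> by (simp add: e_def)
  have c: "0 < c" "c \<le> 1" using False x \<beta> by (simp_all add: c_def powr_le1)
  have "((\<lambda>t. t powr (-2 / \<beta>)) has_integral (1 powr (-e) / (-e)) - (c powr (-e) / (-e))) {c..1}"
  proof (rule fundamental_theorem_of_calculus[OF c(2)])
    fix t assume t: "t \<in> {c..1}"
    then have "t > 0" using c by simp
    then have "((\<lambda>t. t powr (-e) / (-e)) has_field_derivative (-e) * t powr (-e - 1) / (-e)) (at t within {c..1})"
      by (intro DERIV_cdivide has_field_derivative_at_within[OF has_real_derivative_powr])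
    moreover have "(-e) * t powr (-e - 1) / (-e) = t powr (-2 / \<beta>)"
    proof -
      have "-e - 1 = -2 / \<beta>" by (simp add: e_def)
      then show ?thesis using e by simp
    qed
    ultimately show "((\<lambda>t. t powr (-e) / (-e)) has_vector_derivative t powr (-2 / \<beta>)) (at t within {c..1})"
      by (simp only: has_real_derivative_iff_has_vector_derivative)
  qed
  then have "scaled_kernel \<beta> x \<le> ennreal (\<beta> / (\<beta> - 1) * \<bar>x\<bar> powr \<beta> + x\<^sup>2 * ((c powr (-e) - 1) / e))"
    using \<beta> x False by (intro scaled_kernel_le) (simp_all add: c_def diff_divide_distrib)
  also have "\<dots> \<le> ennreal ((\<beta> / (\<beta> - 1) + \<beta> / (2 - \<beta>)) * \<bar>x\<bar> powr \<beta>)"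
  proof (rule ennreal_leI)
    have "c powr (-e) = \<bar>x\<bar> powr (\<beta> - 2)"
      using \<beta> by (simp add: c_def powr_powr e_def algebra_simps)
    then have "x\<^sup>2 * ((c powr (-e) - 1) / e) \<le> x\<^sup>2 * (\<bar>x\<bar> powr (\<beta> - 2) / e)"
      using e by (intro mult_left_mono divide_right_mono) auto
    also have "x\<^sup>2 * (\<bar>x\<bar> powr (\<beta> - 2) / e) = (\<bar>x\<bar> powr 2 * \<bar>x\<bar> powr (\<beta> - 2)) / e"
      using False by (simp add: powr_numeral)
    also have "\<dots> = \<bar>x\<bar> powr \<beta> / e" unfolding powr_add[symmetric] by simp
    also have "\<dots> = \<beta> / (2 - \<beta>) * \<bar>x\<bar> powr \<beta>" using \<beta> by (simp add: e_def field_simps)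
    finally show "\<beta> / (\<beta> - 1) * \<bar>x\<bar> powr \<beta> + x\<^sup>2 * ((c powr (-e) - 1) / e)
      \<le> (\<beta> / (\<beta> - 1) + \<beta> / (2 - \<beta>)) * \<bar>x\<bar> powr \<beta>"
      by (simp add: algebra_simps)
  qed
  also have "\<dots> = ennreal (\<beta> / (\<beta> - 1) + \<beta> / (2 - \<beta>)) * ennreal (\<bar>x\<bar> powr \<beta>)"
    using \<beta> by (intro ennreal_mult) auto
  finally show ?thesis .
qed

text \<open>
For \<open>\<beta> = 2\<close> the quadratic part integrates to \<open>x\<^sup>2 * ln (1 / x\<^sup>2)\<close>. Since \<open>ln (1 / t) \<ge> ln (1 / x\<^sup>2)\<close> for
\<open>t \<le> x\<^sup>2\<close>, this is at most the integral of \<open>ln (1 / t)\<close> over the times with \<open>sqrt t \<le> \<bar>x\<bar>\<close>, the form in which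
the logarithmic condition appears after Tonelli.
\<close>

lemma scaled_kernel_two_le:
  assumes x: "\<bar>x\<bar> < 1"
  shows "scaled_kernel 2 x \<le> 2 * ennreal (x\<^sup>2) + (\<integral>\<^sup>+t\<in>{0<..1}. ennreal (ln (1 / t)) * indicator {t. sqrt t \<le> \<bar>x\<bar>} t \<partial>lborel)"
proof (cases "x = 0")
  case True
  then show ?thesis by (simp add: scaled_kernel_def)
next
  case False
  have x2: "\<bar>x\<bar> powr 2 = x\<^sup>2" using False by (simp add: powr_numeral)
  have c: "0 < x\<^sup>2" "x\<^sup>2 < 1" using False x by (simp_all add: abs_square_less_1)
  have "((\<lambda>t. t powr (-2 / 2)) has_integral ln 1 - ln (x\<^sup>2)) {x\<^sup>2..1}"
  proof (rule fundamental_theorem_of_calculus)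
    fix t assume "t \<in> {x\<^sup>2..1}"
    then have "t > 0" using less_le_trans[OF c(1), of t] by simp
    then show "(ln has_vector_derivative t powr (-2 / 2)) (at t within {x\<^sup>2..1})"
      unfolding has_real_derivative_iff_has_vector_derivative[symmetric]
      by (auto intro!: derivative_eq_intros simp: powr_minus_divide)
  qed (use c in simp)
  then have "scaled_kernel 2 x \<le> ennreal (2 / (2 - 1) * \<bar>x\<bar> powr 2 + x\<^sup>2 * (- ln (x\<^sup>2)))"
    using x False by (intro scaled_kernel_le) (simp_all add: x2)
  also have "\<dots> = 2 * ennreal (x\<^sup>2) + ennreal (x\<^sup>2 * (- ln (x\<^sup>2)))"
    using c by (subst ennreal_plus) (simp_all add: x2 ennreal_mult' mult_le_0_iff)
  also have "ennreal (x\<^sup>2 * (- ln (x\<^sup>2))) = (\<integral>\<^sup>+t. ennreal (- ln (x\<^sup>2)) * indicator {0<..x\<^sup>2} t \<partial>lborel)"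
    using c by (subst nn_integral_cmult_indicator) (simp_all add: mult.commute flip: ennreal_mult'')
  also have "\<dots> \<le> (\<integral>\<^sup>+t\<in>{0<..1}. ennreal (ln (1 / t)) * indicator {t. sqrt t \<le> \<bar>x\<bar>} t \<partial>lborel)"
  proof (intro nn_integral_mono)
    fix t :: real
    show "ennreal (- ln (x\<^sup>2)) * indicator {0<..x\<^sup>2} t
      \<le> ennreal (ln (1 / t)) * indicator {t. sqrt t \<le> \<bar>x\<bar>} t * indicator {0<..1} t"
    proof (cases "t \<in> {0<..x\<^sup>2}")
      case True
      then have "sqrt t \<le> \<bar>x\<bar>" using real_sqrt_le_mono[of t "x\<^sup>2"] by simp
      moreover have "- ln (x\<^sup>2) \<le> ln (1 / t)" using True c by (simp add: ln_div)
      ultimately show ?thesis using True c by (simp add: ennreal_leI)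
    qed simp
  qed
  finally show ?thesis by (simp add: add_left_mono)
qed

text \<open>
At scale \<open>t powr (1 / \<beta>)\<close> the truncated second moment dominates the integrand of \<open>I\<close>, as
\<open>\<beta> / (\<beta> - 1) \<ge> 2\<close>. The drift contributes a multiple of \<open>t powr (-1 / \<beta>)\<close>, which is integrable since \<open>\<beta> > 1\<close>, the
large jumps contribute a constant, and the small jumps are treated by Tonelli.
\<close>

lemma I_integral_finite_if_scaled_kernel:
  assumes X: "levy_process M X" and triplet: "has_levy_triplet M X \<gamma> 0 \<nu>"
    and \<beta>: "1 < \<beta>" "\<beta> \<le> 2"
    and fin: "(\<integral>\<^sup>+x\<in>{-1<..<1}. scaled_kernel \<beta> x \<partial>\<nu>) < \<infinity>"
  shows "I_integral M X \<beta> < \<infinity>"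
proof -
  interpret levy_process M X by fact
  have \<nu>: "levy_measure \<nu>"
    and char_t: "\<And>t u. 0 \<le> t \<Longrightarrow> char (distr M borel (X t)) u = exp (complex_of_real t * levy_exponent \<gamma> 0 \<nu> u)"
    using triplet by (auto simp: has_levy_triplet_def)
  have [measurable_cong]: "sets \<nu> = sets borel" using \<nu> by (simp add: levy_measure_def)
  interpret \<nu>: sigma_finite_measure \<nu> by (rule levy_measure_sigma_finite[OF \<nu>])
  interpret pair_sigma_finite lborel \<nu> by unfold_locales
  define u where "u t = t powr (-1 / \<beta>)" for t
  have [measurable]: "u \<in> borel_measurable borel" unfolding u_def[abs_def] by measurable
  have q: "2 \<le> \<beta> / (\<beta> - 1)" using \<beta> by (simp add: field_simps)
  have pointwise: "ennreal ((LINT \<omega>|M. min ((\<bar>X t \<omega>\<bar> / t powr (1 / \<beta>)) powr (\<beta> / (\<beta> - 1))) 1) / t)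
      \<le> 16 * levy_growth \<gamma> \<nu> (u t)" if t: "t \<in> {0<..1}" for t
  proof -
    have [measurable]: "random_variable borel (X t)" using random_variable t by auto
    let ?f = "\<lambda>\<omega>. min ((\<bar>X t \<omega>\<bar> / t powr (1 / \<beta>)) powr (\<beta> / (\<beta> - 1))) 1"
    have u: "u t = 1 / t powr (1 / \<beta>)" by (simp add: u_def powr_minus_divide)
    have f_le: "?f \<omega> \<le> min 1 ((u t * X t \<omega>)\<^sup>2)" for \<omega>
    proof -
      define y where "y = \<bar>X t \<omega>\<bar> / t powr (1 / \<beta>)"
      have y: "0 \<le> y" "(u t * X t \<omega>)\<^sup>2 = y\<^sup>2" by (simp_all add: y_def u power_divide)
      have "y powr (\<beta> / (\<beta> - 1)) \<le> y\<^sup>2" if "y \<le> 1"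
      proof (cases "y = 0")
        case False
        then have "y powr (\<beta> / (\<beta> - 1)) \<le> y powr 2"
          using y that q by (intro powr_mono') auto
        then show ?thesis using y False by (simp add: powr_numeral)
      qed simp
      moreover have "1 \<le> y\<^sup>2" if "\<not> y \<le> 1" using that by (simp add: one_le_power)
      ultimately show ?thesis unfolding y(2) y_def[symmetric] by (cases "y \<le> 1") (auto simp: min_def)
    qed
    have "ennreal (LINT \<omega>|M. ?f \<omega>) = (\<integral>\<^sup>+\<omega>. ennreal (?f \<omega>) \<partial>M)"
      by (intro nn_integral_eq_integral[symmetric] integrable_const_bound[where B = 1]) auto
    also have "\<dots> \<le> (\<integral>\<^sup>+\<omega>. ennreal (min 1 ((u t * X t \<omega>)\<^sup>2)) \<partial>M)"
      by (intro nn_integral_mono ennreal_leI f_le)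
    also have "\<dots> = (\<integral>\<^sup>+x. ennreal (min 1 ((u t * x)\<^sup>2)) \<partial>distr M borel (X t))"
      by (subst nn_integral_distr) auto
    also have "\<dots> \<le> 16 * (ennreal t * levy_growth \<gamma> \<nu> (u t))"
      using t by (intro truncated_second_moment_le_levy_growth \<nu> real_distribution_law[OF X] char_t) auto
    finally have "ennreal (1 / t) * ennreal (LINT \<omega>|M. ?f \<omega>)
        \<le> ennreal (1 / t) * (16 * (ennreal t * levy_growth \<gamma> \<nu> (u t)))"
      by (rule mult_left_mono) simp
    also have "\<dots> = (ennreal (1 / t) * ennreal t) * (16 * levy_growth \<gamma> \<nu> (u t))" by (simp add: mult_ac)
    also have "ennreal (1 / t) * ennreal t = 1" using t by (simp flip: ennreal_mult')
    also have "ennreal (1 / t) * ennreal (LINT \<omega>|M. ?f \<omega>) = ennreal ((LINT \<omega>|M. ?f \<omega>) / t)"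
      using t by (simp flip: ennreal_mult')
    finally show ?thesis by simp
  qed
  have "I_integral M X \<beta> \<le> (\<integral>\<^sup>+t\<in>{0<..1}. 16 * levy_growth \<gamma> \<nu> (u t) \<partial>lborel)"
    unfolding I_integral_def
  proof (intro nn_integral_mono)
    fix t :: real
    show "ennreal ((LINT \<omega>|M. min ((\<bar>X t \<omega>\<bar> / t powr (1 / \<beta>)) powr (\<beta> / (\<beta> - 1))) 1) / t) * indicator {0<..1} t
      \<le> 16 * levy_growth \<gamma> \<nu> (u t) * indicator {0<..1} t"
    proof (cases "t \<in> {0<..1}")
      case True
      then show ?thesis using pointwise[OF True] by simp
    qed simp
  qed
  also have "\<dots> = (\<integral>\<^sup>+t. 16 * (ennreal \<bar>\<gamma>\<bar> * (ennreal (u t) * indicator {0<..1} t)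
      + 2 * ((\<integral>\<^sup>+x. ennreal (min ((u t * x)\<^sup>2) \<bar>u t * x\<bar>) * indicator {0<..1} t * indicator {-1<..<1} x \<partial>\<nu>)
        + nu_bar \<nu> 1 * indicator {0<..1} t)) \<partial>lborel)"
    by (intro nn_integral_cong)
      (auto simp: levy_growth_def abs_mult u_def ennreal_mult' indicator_def)
  also have "\<dots> = 16 * (ennreal \<bar>\<gamma>\<bar> * (\<integral>\<^sup>+t\<in>{0<..1}. ennreal (u t) \<partial>lborel)
      + 2 * ((\<integral>\<^sup>+t. (\<integral>\<^sup>+x. ennreal (min ((u t * x)\<^sup>2) \<bar>u t * x\<bar>) * indicator {0<..1} t * indicator {-1<..<1} x \<partial>\<nu>) \<partial>lborel)
        + nu_bar \<nu> 1))"
    by (simp add: nn_integral_cmult nn_integral_add nn_integral_cmult_indicator)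
  also have "(\<integral>\<^sup>+t. (\<integral>\<^sup>+x. ennreal (min ((u t * x)\<^sup>2) \<bar>u t * x\<bar>) * indicator {0<..1} t * indicator {-1<..<1} x \<partial>\<nu>) \<partial>lborel)
      = (\<integral>\<^sup>+x. (\<integral>\<^sup>+t. ennreal (min ((u t * x)\<^sup>2) \<bar>u t * x\<bar>) * indicator {0<..1} t * indicator {-1<..<1} x \<partial>lborel) \<partial>\<nu>)"
    by (rule Fubini'[symmetric]) measurable
  also have "\<dots> = (\<integral>\<^sup>+x\<in>{-1<..<1}. scaled_kernel \<beta> x \<partial>\<nu>)"
    unfolding scaled_kernel_def u_def[symmetric] by (intro nn_integral_cong nn_integral_multc) measurable
  finally have le: "I_integral M X \<beta> \<le> 16 * (ennreal \<bar>\<gamma>\<bar> * (\<integral>\<^sup>+t\<in>{0<..1}. ennreal (u t) \<partial>lborel)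
      + 2 * ((\<integral>\<^sup>+x\<in>{-1<..<1}. scaled_kernel \<beta> x \<partial>\<nu>) + nu_bar \<nu> 1))" .
  have "(\<integral>\<^sup>+t\<in>{0<..1}. ennreal (u t) \<partial>lborel) \<le> (\<integral>\<^sup>+t\<in>{0..1}. ennreal (u t) \<partial>lborel)"
    by (intro nn_integral_mono) (auto simp: indicator_def)
  also have "\<dots> < \<infinity>"
    using \<beta> nn_integral_powr_0[of "-1 / \<beta>" 1] by (simp add: u_def)
  finally show ?thesis
    using fin nu_bar_finite[OF \<nu>, of 1]
    by (intro le_less_trans[OF le]) (simp add: ennreal_mult_less_top)
qed

section \<open>Finiteness of the jump integral\<close>

text \<open>
The terms of a convergent series tend to \<open>0\<close>, so all but finitely many minima are attained by \<open>w\<close>.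
\<close>

lemma summable_if_summable_min:
  fixes w :: "nat \<Rightarrow> real"
  assumes c: "0 < c" and sum: "summable (\<lambda>k. min c (w k))"
  shows "summable w"
proof -
  have "(\<lambda>k. min c (w k)) \<longlonglongrightarrow> 0" by (rule summable_LIMSEQ_zero[OF sum])
  then have "\<forall>\<^sub>F k in sequentially. min c (w k) < c" by (rule order_tendstoD(2)[OF _ c])
  then have "\<forall>\<^sub>F k in sequentially. w k = min c (w k)" by (rule eventually_mono) (simp add: min_def split: if_splits)
  then show ?thesis using sum summable_cong[of w "\<lambda>k. min c (w k)"] by simp
qed

text \<open>
Each dyadic interval has measure \<open>(1/2) ^ Suc k\<close> and \<open>1 / t \<ge> 2 ^ k\<close> on it, so it contributes at least
\<open>d k / 2\<close>.
\<close>

lemma nn_integral_ge_dyadic_sum: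
  fixes f :: "real \<Rightarrow> real" and d :: "nat \<Rightarrow> real"
  assumes d: "\<And>k. 0 \<le> d k"
    and le: "\<And>k t. (1/2) ^ Suc k < t \<Longrightarrow> t \<le> (1/2) ^ k \<Longrightarrow> d k \<le> f t"
    and fin: "(\<integral>\<^sup>+t\<in>{0<..1}. ennreal (f t / t) \<partial>lborel) < \<infinity>"
  shows "summable d"
proof -
  define S where "S k = {(1/2) ^ Suc k <.. (1/2 :: real) ^ k}" for k
  have disj: "k = l" if "t \<in> S k" "t \<in> S l" for k l t
  proof -
    have False if "t \<in> S k" "t \<in> S l" "k < l" for k l
    proof -
      have "(1/2 :: real) ^ l \<le> (1/2) ^ Suc k" using that by (intro power_decreasing) auto
      then show False using that by (auto simp: S_def)
    qed
    then show ?thesis using that by (metis linorder_neqE_nat)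
  qed
  have "(\<Sum>k. ennreal (d k / 2)) = (\<Sum>k. \<integral>\<^sup>+t. ennreal (d k * 2 ^ k) * indicator (S k) t \<partial>lborel)"
  proof (rule suminf_cong)
    fix k
    have "(\<integral>\<^sup>+t. ennreal (d k * 2 ^ k) * indicator (S k) t \<partial>lborel) = ennreal (d k * 2 ^ k) * ennreal ((1/2) ^ k - (1/2) ^ Suc k)"
      by (subst nn_integral_cmult_indicator) (simp_all add: S_def)
    also have "\<dots> = ennreal (d k * 2 ^ k * ((1/2) ^ k - (1/2) ^ Suc k))"
      using d by (intro ennreal_mult[symmetric]) auto
    also have "d k * 2 ^ k * ((1/2) ^ k - (1/2) ^ Suc k) = d k / 2"
      by (simp add: field_simps power_one_over)
    finally show "ennreal (d k / 2) = (\<integral>\<^sup>+t. ennreal (d k * 2 ^ k) * indicator (S k) t \<partial>lborel)" by simp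
  qed
  also have "\<dots> = (\<integral>\<^sup>+t. (\<Sum>k. ennreal (d k * 2 ^ k) * indicator (S k) t) \<partial>lborel)"
    by (rule nn_integral_suminf[symmetric]) (simp add: S_def)
  also have "\<dots> \<le> (\<integral>\<^sup>+t\<in>{0<..1}. ennreal (f t / t) \<partial>lborel)"
  proof (intro nn_integral_mono)
    fix t :: real
    show "(\<Sum>k. ennreal (d k * 2 ^ k) * indicator (S k) t) \<le> ennreal (f t / t) * indicator {0<..1} t"
    proof (cases "\<exists>k. t \<in> S k")
      case True
      then obtain k where k: "t \<in> S k" by auto
      then have t: "(1/2) ^ Suc k < t" "t \<le> (1/2) ^ k" by (auto simp: S_def)
      have "0 < t" using t(1) by (rule le_less_trans[rotated]) simp
      moreover have "t \<le> 1" using t(2) by (rule order_trans) (simp add: power_le_one)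
      moreover have "d k * 2 ^ k \<le> d k / t"
      proof -
        have "2 ^ k * t \<le> 1" using t(2) by (simp add: field_simps power_one_over)
        then have "d k * (2 ^ k * t) \<le> d k * 1" by (intro mult_left_mono d)
        then show ?thesis using \<open>0 < t\<close> by (simp add: field_simps)
      qed
      moreover have "d k / t \<le> f t / t" using \<open>0 < t\<close> le[OF t] by (simp add: divide_right_mono)
      moreover have "(\<Sum>k. ennreal (d k * 2 ^ k) * indicator (S k) t)
          = (\<Sum>l\<in>{k}. ennreal (d l * 2 ^ l) * indicator (S l) t)"
        using disj[OF k] by (intro suminf_finite) (auto simp: indicator_def)
      ultimately show ?thesis using k by (simp add: ennreal_leI)
    qed simp
  qed
  finally have "(\<Sum>k. ennreal (d k / 2)) < \<infinity>" using fin by (rule le_less_trans)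
  then have "summable (\<lambda>k. d k / 2)" using d by (intro summable_suminf_not_top) auto
  then show ?thesis by (simp add: summable_divide_iff)
qed

text \<open>
For \<open>0 < \<bar>x\<bar> < 1\<close> let \<open>k\<close> be the first index with \<open>(1/2) ^ k \<le> (\<bar>x\<bar> / c) powr \<beta>\<close>. Then \<open>\<bar>x\<bar>\<close> is at least the
radius of index \<open>k\<close>, and by minimality \<open>\<bar>x\<bar> powr \<beta> \<le> 2 * c powr \<beta> * (1/2) ^ k\<close>; the single term \<open>k\<close> of the
series therefore dominates. The hypothesis \<open>c \<ge> 1\<close> ensures \<open>k > 0\<close>.
\<close>

lemma J_integral_finite_if_dyadic_summable:
  fixes c \<beta> :: real
  assumes \<nu>: "levy_measure \<nu>" and c: "1 \<le> c" and \<beta>: "0 < \<beta>"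
    and sum: "summable (\<lambda>k. (1/2) ^ k * measure \<nu> (UNIV - {- (c * ((1/2) ^ k) powr (1 / \<beta>)) <..< c * ((1/2) ^ k) powr (1 / \<beta>)}))"
  shows "J_integral \<nu> \<beta> < \<infinity>"
proof -
  have [measurable_cong]: "sets \<nu> = sets borel" using \<nu> by (simp add: levy_measure_def)
  define r where "r k = c * ((1/2) ^ k) powr (1 / \<beta>)" for k :: nat
  define T where "T k = UNIV - {- r k <..< r k}" for k
  have r: "0 < r k" for k using c by (simp add: r_def)
  have em: "emeasure \<nu> (T k) = ennreal (measure \<nu> (T k))" for k
    using nu_bar_finite[OF \<nu> r[of k]] by (intro emeasure_eq_ennreal_measure) (simp add: T_def nu_bar_def)
  have T_meas [measurable]: "T k \<in> sets borel" for k by (simp add: T_def)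
  have "J_integral \<nu> \<beta> \<le> (\<integral>\<^sup>+x. ennreal (2 * c powr \<beta>) * (\<Sum>k. ennreal ((1/2) ^ k) * indicator (T k) x) \<partial>\<nu>)"
    unfolding J_integral_def
  proof (intro nn_integral_mono)
    fix x :: real
    show "ennreal (\<bar>x\<bar> powr \<beta>) * indicator {-1<..<1} x
      \<le> ennreal (2 * c powr \<beta>) * (\<Sum>k. ennreal ((1/2) ^ k) * indicator (T k) x)"
    proof (cases "x \<in> {-1<..<1} \<and> x \<noteq> 0")
      case True
      define s where "s = (\<bar>x\<bar> / c) powr \<beta>"
      have "\<bar>x\<bar> / c < 1" using True c by (auto simp: abs_if)
      then have s: "0 < s" "s < 1"
        using True c \<beta> powr_less_mono2[of \<beta> "\<bar>x\<bar> / c" 1] by (auto simp: s_def)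
      define k where "k = (LEAST k. (1/2) ^ k \<le> s)"
      have ex: "\<exists>k. (1/2) ^ k \<le> s"
        using real_arch_pow_inv[of s "1/2"] s by (auto intro: less_imp_le)
      have k: "(1/2) ^ k \<le> s" unfolding k_def by (rule LeastI_ex[OF ex])
      have "k \<noteq> 0" using k s by (intro notI) simp
      then have "s < (1/2) ^ (k - 1)"
        using not_less_Least[of "k - 1" "\<lambda>k. (1/2) ^ k \<le> s"] unfolding k_def by linarith
      also have "(1/2) ^ (k - 1) = 2 * (1/2 :: real) ^ k" using \<open>k \<noteq> 0\<close> by (cases k) auto
      finally have sk: "s \<le> 2 * (1/2) ^ k" by simp
      have "((1/2) ^ k) powr (1 / \<beta>) \<le> s powr (1 / \<beta>)" using k \<beta> by (intro powr_mono2) auto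
      also have "\<dots> = \<bar>x\<bar> / c" using \<beta> c True by (simp add: s_def powr_powr)
      finally have "r k \<le> \<bar>x\<bar>" using c by (simp add: r_def field_simps)
      then have xT: "x \<in> T k" by (auto simp: T_def)
      have "\<bar>x\<bar> powr \<beta> = c powr \<beta> * s" using c by (simp add: s_def powr_divide)
      also have "\<dots> \<le> 2 * c powr \<beta> * (1/2) ^ k" using mult_left_mono[OF sk, of "c powr \<beta>"] by simp
      finally have "ennreal (\<bar>x\<bar> powr \<beta>) \<le> ennreal (2 * c powr \<beta>) * (ennreal ((1/2) ^ k) * indicator (T k) x)"
        using xT by (simp add: ennreal_leI flip: ennreal_mult')
      also have "ennreal ((1/2) ^ k) * indicator (T k) x \<le> (\<Sum>k. ennreal ((1/2) ^ k) * indicator (T k) x)"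
      proof -
        have "F k \<le> suminf F" for F :: "nat \<Rightarrow> ennreal"
          using sum_le_suminf[of F "{k}"] by simp
        then show ?thesis .
      qed
      finally show ?thesis using True by (simp add: mult_left_mono)
    qed auto
  qed
  also have "\<dots> = ennreal (2 * c powr \<beta>) * (\<Sum>k. ennreal ((1/2) ^ k) * emeasure \<nu> (T k))"
    by (simp add: nn_integral_cmult nn_integral_suminf nn_integral_cmult_indicator)
  also have "(\<Sum>k. ennreal ((1/2) ^ k) * emeasure \<nu> (T k)) = (\<Sum>k. ennreal ((1/2) ^ k * measure \<nu> (T k)))"
    unfolding em by (simp add: ennreal_mult')
  also have "\<dots> = ennreal (\<Sum>k. (1/2) ^ k * measure \<nu> (T k))"
    using sum by (intro suminf_ennreal2) (simp_all add: T_def r_def)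
  also have "ennreal (2 * c powr \<beta>) * \<dots> < \<infinity>" by (simp add: ennreal_mult_less_top)
  finally show ?thesis .
qed

text \<open>
The integrand of \<open>I\<close> at time \<open>t\<close> is at least \<open>P(\<bar>X t\<bar> \<ge> t powr (1 / \<beta>))\<close>. Either this exceeds \<open>1 / 256\<close>, or it
controls the tail of \<open>\<nu>\<close>; so on the dyadic interval \<open>k\<close> it is at least \<open>min (1 / 256) (w k)\<close>.
\<close>

lemma J_integral_finite_if_I_integral:
  assumes X: "levy_process M X" and triplet: "has_levy_triplet M X \<gamma> 0 \<nu>"
    and \<beta>: "1 < \<beta>" and fin: "I_integral M X \<beta> < \<infinity>"
  shows "J_integral \<nu> \<beta> < \<infinity>"
proof -
  interpret levy_process M X by fact
  have \<nu>: "levy_measure \<nu>" using triplet by (simp add: has_levy_triplet_def)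
  have sets [measurable_cong]: "sets \<nu> = sets borel" using \<nu> by (simp add: levy_measure_def)
  define r where "r k = 512 * ((1/2) ^ k) powr (1 / \<beta>)" for k :: nat
  \<comment> \<open>One factor \<open>1/2\<close> comes from \<open>t > (1/2) ^ Suc k\<close>, the other from the constant 2 in \<open>levy_measure_tail_le\<close>.\<close>
  define w where "w k = (1/2) ^ k * measure \<nu> (UNIV - {- r k <..< r k}) / 4" for k
  define f where "f t = (LINT \<omega>|M. min ((\<bar>X t \<omega>\<bar> / t powr (1 / \<beta>)) powr (\<beta> / (\<beta> - 1))) 1)" for t
  have "summable (\<lambda>k. min (1 / 256) (w k))"
  proof (rule nn_integral_ge_dyadic_sum)
    show "0 \<le> min (1 / 256) (w k)" for k by (simp add: w_def)
    show "(\<integral>\<^sup>+t\<in>{0<..1}. ennreal (f t / t) \<partial>lborel) < \<infinity>"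
      using fin by (simp add: I_integral_def f_def)
    fix k and t :: real
    assume t: "(1/2) ^ Suc k < t" "t \<le> (1/2) ^ k"
    have t0: "0 < t" using t(1) by (rule le_less_trans[rotated]) simp
    have [measurable]: "random_variable borel (X t)" using random_variable t0 by auto
    define a where "a = t powr (1 / \<beta>)"
    have a: "0 < a" using t0 by (simp add: a_def)
    define p where "p = measure (distr M borel (X t)) {x. a \<le> \<bar>x\<bar>}"
    have "p = prob {\<omega> \<in> space M. a \<le> \<bar>X t \<omega>\<bar>}"
      unfolding p_def by (subst measure_distr) (auto intro!: arg_cong[where f = prob])
    also have "\<dots> = (LINT \<omega>|M. indicator {\<omega> \<in> space M. a \<le> \<bar>X t \<omega>\<bar>} \<omega>)" by simp
    also have "\<dots> \<le> f t"
      unfolding f_def a_def[symmetric]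
    proof (rule integral_mono)
      show "integrable M (\<lambda>\<omega>. min ((\<bar>X t \<omega>\<bar> / a) powr (\<beta> / (\<beta> - 1))) 1)"
        by (intro integrable_const_bound[where B = 1]) auto
      show "indicator {\<omega> \<in> space M. a \<le> \<bar>X t \<omega>\<bar>} \<omega> \<le> min ((\<bar>X t \<omega>\<bar> / a) powr (\<beta> / (\<beta> - 1))) 1" for \<omega>
        using a \<beta> by (auto simp: indicator_def intro!: ge_one_powr_ge_zero)
    qed (simp add: less_top[symmetric])
    finally have p_le: "p \<le> f t" .
    show "min (1 / 256) (w k) \<le> f t"
    proof (cases "p \<le> 1 / 256")
      case True
      have "512 * a \<le> r k"
        using t(2) t0 \<beta> by (auto simp: r_def a_def intro!: powr_mono2)
      then have "nu_bar \<nu> (r k) \<le> nu_bar \<nu> (512 * a)"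
        unfolding nu_bar_def by (intro emeasure_mono) (auto simp: sets)
      moreover have "nu_bar \<nu> (r k) = ennreal (measure \<nu> (UNIV - {- r k <..< r k}))"
        using nu_bar_finite[OF \<nu>, of "r k"]
        by (simp add: nu_bar_def r_def emeasure_eq_ennreal_measure)
      ultimately have "ennreal ((1/2) ^ Suc k) * ennreal (measure \<nu> (UNIV - {- r k <..< r k})) \<le> ennreal t * nu_bar \<nu> (512 * a)"
        using t(1) by (intro mult_mono ennreal_leI) auto
      also have "\<dots> \<le> ennreal (2 * p)"
        unfolding p_def using True[unfolded p_def] by (rule levy_measure_tail_le[OF X triplet t0 a])
      finally have "ennreal (2 * w k) \<le> ennreal (2 * p)"
        by (simp add: w_def flip: ennreal_mult')
      moreover have "0 \<le> p" by (simp add: p_def)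
      ultimately show ?thesis using p_le by (auto simp: ennreal_le_iff min_le_iff_disj)
    next
      case False
      then show ?thesis using p_le by simp
    qed
  qed
  then have "summable w" by (rule summable_if_summable_min[rotated]) simp
  then have "summable (\<lambda>k. (1/2) ^ k * measure \<nu> (UNIV - {- r k <..< r k}))"
    unfolding w_def by (simp add: summable_divide_iff)
  then show ?thesis
    unfolding r_def using \<beta> by (intro J_integral_finite_if_dyadic_summable[OF \<nu>, of 512]) auto
qed

theorem proposition1p4:
  fixes M :: "'a measure" and X :: "real \<Rightarrow> 'a \<Rightarrow> real"
    and \<gamma> \<sigma> \<beta> :: real and \<nu> :: "real measure"
  assumes "levy_process M X"
    and "infinite_variation M X"
    and "has_levy_triplet M X \<gamma> \<sigma> \<nu>"
    and "\<sigma> = 0"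
    and "\<beta> = blumenthal_getoor_index \<nu>"
  shows "(1 < \<beta> \<and> \<beta> < 2 \<longrightarrow> (J_integral \<nu> \<beta> < \<infinity> \<longleftrightarrow> I_integral M X \<beta> < \<infinity>)) \<and>
         (\<beta> = 2 \<longrightarrow>
            (\<integral>\<^sup>+t\<in>{0<..1}. ennreal (ln (1 / t)) * nu_bar \<nu> (sqrt t) \<partial>lborel) < \<infinity> \<longrightarrow>
            I_integral M X 2 < \<infinity>)"
proof -
  note X = assms(1)
  have triplet: "has_levy_triplet M X \<gamma> 0 \<nu>" using assms(3,4) by simp
  have \<nu>: "levy_measure \<nu>" using triplet by (simp add: has_levy_triplet_def)
  have sets [measurable_cong]: "sets \<nu> = sets borel" using \<nu> by (simp add: levy_measure_def)
  interpret \<nu>: sigma_finite_measure \<nu> by (rule levy_measure_sigma_finite[OF \<nu>])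
  interpret pair_sigma_finite lborel \<nu> by unfold_locales
  have sub: "I_integral M X \<beta> < \<infinity>" if \<beta>: "1 < \<beta>" "\<beta> < 2" and J: "J_integral \<nu> \<beta> < \<infinity>"
  proof (rule I_integral_finite_if_scaled_kernel[OF X triplet])
    let ?C = "ennreal (\<beta> / (\<beta> - 1) + \<beta> / (2 - \<beta>))"
    have "(\<integral>\<^sup>+x\<in>{-1<..<1}. scaled_kernel \<beta> x \<partial>\<nu>) \<le> (\<integral>\<^sup>+x. ?C * (ennreal (\<bar>x\<bar> powr \<beta>) * indicator {-1<..<1} x) \<partial>\<nu>)"
      using scaled_kernel_le_powr[OF \<beta>] by (intro nn_integral_mono) (auto simp: indicator_def)
    also have "\<dots> = ?C * J_integral \<nu> \<beta>"
      unfolding J_integral_def by (intro nn_integral_cmult) measurable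
    also have "\<dots> < \<infinity>" using J by (simp add: ennreal_mult_less_top)
    finally show "(\<integral>\<^sup>+x\<in>{-1<..<1}. scaled_kernel \<beta> x \<partial>\<nu>) < \<infinity>" .
  qed (use \<beta> in simp_all)
  have crit: "I_integral M X 2 < \<infinity>"
    if fin: "(\<integral>\<^sup>+t\<in>{0<..1}. ennreal (ln (1 / t)) * nu_bar \<nu> (sqrt t) \<partial>lborel) < \<infinity>"
  proof (rule I_integral_finite_if_scaled_kernel[OF X triplet])
    let ?g = "\<lambda>t x. ennreal (ln (1 / t)) * indicator {t. sqrt t \<le> \<bar>x\<bar>} t * indicator {0<..1} t"
    have ind: "indicator {t. sqrt t \<le> \<bar>x\<bar>} t = (if sqrt t \<le> \<bar>x\<bar> then 1 else 0 :: ennreal)" for t x :: real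
      by simp
    have "(\<integral>\<^sup>+x\<in>{-1<..<1}. scaled_kernel 2 x \<partial>\<nu>) \<le> (\<integral>\<^sup>+x. 2 * ennreal (min 1 (x\<^sup>2)) + (\<integral>\<^sup>+t. ?g t x \<partial>lborel) \<partial>\<nu>)"
    proof (intro nn_integral_mono)
      fix x :: real
      show "scaled_kernel 2 x * indicator {-1<..<1} x \<le> 2 * ennreal (min 1 (x\<^sup>2)) + (\<integral>\<^sup>+t. ?g t x \<partial>lborel)"
      proof (cases "x \<in> {-1<..<1}")
        case True
        then have "\<bar>x\<bar> < 1" by auto
        moreover have "min 1 (x\<^sup>2) = x\<^sup>2" using \<open>\<bar>x\<bar> < 1\<close> by (simp add: abs_square_le_1)
        ultimately show ?thesis using True scaled_kernel_two_le[of x] by simp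
      qed simp
    qed
    also have "\<dots> = 2 * (\<integral>\<^sup>+x. ennreal (min 1 (x\<^sup>2)) \<partial>\<nu>) + (\<integral>\<^sup>+x. (\<integral>\<^sup>+t. ?g t x \<partial>lborel) \<partial>\<nu>)"
      unfolding ind by (simp add: nn_integral_add nn_integral_cmult)
    also have "(\<integral>\<^sup>+x. (\<integral>\<^sup>+t. ?g t x \<partial>lborel) \<partial>\<nu>) = (\<integral>\<^sup>+t. (\<integral>\<^sup>+x. ?g t x \<partial>\<nu>) \<partial>lborel)"
      unfolding ind by (rule Fubini') measurable
    also have "\<dots> = (\<integral>\<^sup>+t\<in>{0<..1}. ennreal (ln (1 / t)) * nu_bar \<nu> (sqrt t) \<partial>lborel)"
    proof (intro nn_integral_cong)
      fix t :: real
      show "(\<integral>\<^sup>+x. ?g t x \<partial>\<nu>) = ennreal (ln (1 / t)) * nu_bar \<nu> (sqrt t) * indicator {0<..1} t"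
      proof (cases "t \<in> {0<..1}")
        case True
        have "(\<integral>\<^sup>+x. ?g t x \<partial>\<nu>) = (\<integral>\<^sup>+x. ennreal (ln (1 / t)) * indicator (UNIV - {- sqrt t <..< sqrt t}) x \<partial>\<nu>)"
          using True by (intro nn_integral_cong) (auto simp: indicator_def)
        then show ?thesis using True by (simp add: nn_integral_cmult_indicator nu_bar_def)
      qed simp
    qed
    also have "2 * (\<integral>\<^sup>+x. ennreal (min 1 (x\<^sup>2)) \<partial>\<nu>) + \<dots> < \<infinity>"
      using fin \<nu> by (simp add: levy_measure_def ennreal_mult_less_top)
    finally show "(\<integral>\<^sup>+x\<in>{-1<..<1}. scaled_kernel 2 x \<partial>\<nu>) < \<infinity>" .
  qed simp_all
  show ?thesis
    using sub crit J_integral_finite_if_I_integral[OF X triplet, of \<beta>] by auto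
qed

end
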